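(* Let $K$ be a finite simplicial complex, and let $S_1,\ldots,S_{n+1}$ be isolated invariant sets under multivector fields $\mathcal{V}_1,\ldots,\mathcal{V}_{n+1}$ on $K$, respectively. Let $\{(P_i,E_i)\}_{i=1}^n$ be a sequence of connecting index pairs, i.e. for each $1\le i\le n$, $(P_i,E_i)$ is an index pair for $S_i$ under $\mathcal{V}_i$ and for $S_{i+1}$ under $\mathcal{V}_{i+1}$. Then for every $k\geq 0$, if $\dim H_k(P_1,E_1)=m$, the $k$-dimensional barcode of $\{(P_i,E_i)\}_{i=1}^n$ has $m$ bars $[1,n]$, i.e. $m$ bars that extend from $(P_1,E_1)$ to $(P_n,E_n)$ over the entire zigzag filtration associated with the sequence.
   Context: $K$ is a finite simplicial complex, viewed as the finite set of its (nonempty) simplices; $\leq$ is the face relation. Homology is simplicial homology with coefficients in a fixed finite field. Closure and mouth: $\mathrm{cl}(\sigma) = \{\tau \in K : \tau \leq \sigma\}$, $\mathrm{cl}(A) = \bigcup_{\sigma\in A}\mathrm{cl}(\sigma)$ for $A\subseteq K$; $A$ is closed if $A=\mathrm{cl}(A)$; $\mathrm{mo}(A) = \mathrm{cl}(A)\setminus A$. A set $A\subseteq K$ is convex if $\sigma\leq\rho\leq\tau$ with $\sigma,\tau\in A$, $\rho\in K$ implies $\rho\in A$. A multivector is a convex subset of $K$; a multivector field on $K$ is a partition of $K$ into multivectors. $[\sigma]_{\mathcal{V}}$ is the unique multivector of $\mathcal{V}$ containing $\sigma$. A multivector $V$ is critical if $H(\mathrm{cl}(V),\mathrm{mo}(V))\neq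 0$. Dynamics: $F_{\mathcal{V}}(\sigma)=\mathrm{cl}(\sigma)\cup[\sigma]_{\mathcal{V}}$, and $F_{\mathcal{V}}(A)=\bigcup_{\sigma\in A}F_{\mathcal{V}}(\sigma)$. A path (in $\mathcal{V}$) is a map $\rho:\mathbb{Z}\cap[0,n]\to K$ with $\rho(i+1)\in F_{\mathcal{V}}(\rho(i))$ for $0\le i\le n-1$; a solution is a map $\rho:\mathbb{Z}\to K$ with $\rho(i+1)\in F_{\mathcal{V}}(\rho(i))$ for all $i\in\mathbb{Z}$. A solution $\rho$ is essential if for every $i$ with $[\rho(i)]_{\mathcal{V}}$ not critical there exist $i^-<i<i^+$ with $[\rho(i^-)]_{\mathcal{V}}\neq[\rho(i)]_{\mathcal{V}}\neq[\rho(i^+)]_{\mathcal{V}}$. Invariant sets: $\mathrm{Inv}_{\mathcal{V}}(A)$ is the set of $\sigma\in A$ for which there is an essential solution $\rho:\mathbb{Z}\to A$ (under $\mathcal{V}$) with $\rho(i)=\sigma$ for some $i$. $S$ is an invariant set under $\mathcal{V}$ if $S=\mathrm{Inv}_{\mathcal{V}}(S)$. An invariant set $S$ is an isolated invariant set under $\mathcal{V}$ if there is a closed set $N$ (an isolating set for $S$) with $F_{\mathcal{V}}(S)\subseteq N$ such that every path $\rho:\mathbb{Z}\cap[0,n]\to N$ with $\rho(0),\rho(n)\in S$ has its whole image in $S$. Index pair: for an isolated invariant set $S$ under $\mathcal{V}$ and closed sets $E\subseteq P\subseteq K$, $(P,E)$ is an index pair for $S$ (under $\mathcal{V}$) if (1)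 $F_{\mathcal{V}}(P\setminus E)\subseteq P$; (2) $F_{\mathcal{V}}(E)\cap P\subseteq E$; (3) $S=\mathrm{Inv}_{\mathcal{V}}(P\setminus E)$. Push forward: $\mathrm{pf}_{\mathcal{V}}(A,N)$ is the set of $\sigma\in N$ for which there is a path $\rho:\mathbb{Z}\cap[0,n]\to N$ in $\mathcal{V}$ with $\rho(0)\in A$ and $\rho(n)=\sigma$. Zigzag filtration of a sequence of connecting index pairs: inclusion of pairs $(A,B)\subseteq(A',B')$ means $A\subseteq A'$ and $B\subseteq B'$. For $1<i\le n$ and $j\in\{i-1,i\}$, put $Q_{i,j}=(\mathrm{pf}_{\mathcal{V}_i}(\mathrm{cl}(S_i),P_j),\ \mathrm{pf}_{\mathcal{V}_i}(\mathrm{mo}(S_i),P_j))$ and $R_{i,j}=(P_j\cap \mathrm{pf}_{\mathcal{V}_i}(\mathrm{cl}(S_i),P_j),\ E_j\cap\mathrm{pf}_{\mathcal{V}_i}(\mathrm{mo}(S_i),P_j))$. The consecutive pairs $(P_{i-1},E_{i-1})$ and $(P_i,E_i)$ are connected by $$(P_{i-1},E_{i-1})\supseteq R_{i,i-1}\subseteq Q_{i,i-1}\supseteq(\mathrm{cl}(S_i),\mathrm{mo}(S_i))\subseteq Q_{i,i}\supseteq R_{i,i}\subseteq(P_i,E_i),$$ and the zigzag filtration of the sequence is the concatenation of these for $i=2,\ldots,n$; it starts at $(P_1,E_1)$ and ends at $(P_n,E_n)$. The $k$-dimensional barcode of the sequence is the barcode (interval decomposition) of the zigzag persistence module obtained by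 applying relative homology $H_k$ to this zigzag filtration, with maps induced by inclusions. A bar $[1,n]$ denotes the interval spanning the entire filtration from $(P_1,E_1)$ to $(P_n,E_n)$. *)

theory Defs
  imports "Jordan_Normal_Form.VS_Connect" "HOL-Algebra.AbelCoset" "HOL-Library.Disjoint_Sets"
begin

text \<open>Vector spaces over a field type \<^typ>\<open>'f\<close> are \<^locale>\<open>vectorspace\<close>s over
  \<^const>\<open>class_ring\<close>.  Their ring fields \<^const>\<open>mult\<close> and \<^const>\<open>one\<close> carry no
  information and are filled with zeros, as in \<^const>\<open>direct_sum\<close>.\<close>

definition quotient_space :: "('f::field, 'a) module \<Rightarrow> 'a set \<Rightarrow> ('f, 'a set) module" where
  "quotient_space M W =
     \<lparr>carrier = a_rcosets\<^bsub>M\<^esub> W,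
      mult = (\<lambda>_ _. W), one = W, zero = W,
      add = (\<lambda>X Y. X <+>\<^bsub>M\<^esub> Y),
      smult = (\<lambda>a X. \<Union>x\<in>X. W +>\<^bsub>M\<^esub> (a \<odot>\<^bsub>M\<^esub> x))\<rparr>"

definition direct_sum_list :: "('f::field, 'a) module list \<Rightarrow> ('f, nat \<Rightarrow> 'a) module" where
  "direct_sum_list Ms =
     (let J = {..<length Ms}; z = (\<lambda>j\<in>J. \<zero>\<^bsub>Ms ! j\<^esub>) in
      \<lparr>carrier = (\<Pi>\<^sub>E j\<in>J. carrier (Ms ! j)),
       mult = (\<lambda>_ _. z), one = z, zero = z,
       add = (\<lambda>x y. \<lambda>j\<in>J. x j \<oplus>\<^bsub>Ms ! j\<^esub> y j),
       smult = (\<lambda>a x. \<lambda>j\<in>J. a \<odot>\<^bsub>Ms ! j\<^esub> x j)\<rparr>)"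


section \<open>Zigzag persistence modules\<close>

text \<open>A zigzag module of type \<open>\<tau>\<close> consists of the spaces \<open>space M i\<close> for
  \<open>i \<le> length \<tau>\<close> and, for every \<open>i < length \<tau>\<close>, the linear map \<open>arrow M i\<close> from
  \<open>space M i\<close> to \<open>space M (Suc i)\<close> if \<open>\<tau> ! i\<close> is \<open>Forward\<close> and in the opposite direction
  if it is \<open>Backward\<close>.\<close>

datatype direction = Forward | Backward

record ('f, 'a) zigzag =
  space :: "nat \<Rightarrow> ('f, 'a) module"
  arrow :: "nat \<Rightarrow> 'a \<Rightarrow> 'a"

definition zigzag_iso ::
    "direction list \<Rightarrow> ('f::field, 'a) zigzag \<Rightarrow> ('f, 'b) zigzag \<Rightarrow> bool" where
  "zigzag_iso \<tau> M N \<longleftrightarrow>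
     (\<exists>\<phi>. (\<forall>i\<le>length \<tau>. linear_map class_ring (space M i) (space N i) (\<phi> i) \<and>
                bij_betw (\<phi> i) (carrier (space M i)) (carrier (space N i))) \<and>
          (\<forall>i<length \<tau>. case \<tau> ! i of
             Forward \<Rightarrow> arrow M i \<in> carrier (space M i) \<rightarrow> carrier (space M (Suc i)) \<and>
               (\<forall>x\<in>carrier (space M i). \<phi> (Suc i) (arrow M i x) = arrow N i (\<phi> i x))
           | Backward \<Rightarrow> arrow M i \<in> carrier (space M (Suc i)) \<rightarrow> carrier (space M i) \<and>
               (\<forall>x\<in>carrier (space M (Suc i)). \<phi> i (arrow M i x) = arrow N i (\<phi> (Suc i) x))))"

definition interval_module :: "nat \<times> nat \<Rightarrow> ('f::field, 'f) zigzag" where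
  "interval_module I =
     \<lparr>space = (\<lambda>i. \<lparr>carrier = (if i \<in> {fst I..snd I} then UNIV else {0}),
                    mult = (\<lambda>_ _. 0), one = 0, zero = 0, add = (+), smult = (*)\<rparr>),
      arrow = (\<lambda>i x. if i \<in> {fst I..snd I} \<and> Suc i \<in> {fst I..snd I} then x else 0)\<rparr>"

definition zigzag_sum :: "('f::field, 'a) zigzag list \<Rightarrow> ('f, nat \<Rightarrow> 'a) zigzag" where
  "zigzag_sum Ms =
     \<lparr>space = (\<lambda>i. direct_sum_list (map (\<lambda>M. space M i) Ms)),
      arrow = (\<lambda>i x. \<lambda>j\<in>{..<length Ms}. arrow (Ms ! j) i (x j))\<rparr>"

definition is_barcode ::
    "direction list \<Rightarrow> ('f::field, 'a) zigzag \<Rightarrow> (nat \<times> nat) multiset \<Rightarrow> bool" where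
  "is_barcode \<tau> M B \<longleftrightarrow>
     (\<forall>I\<in>#B. fst I \<le> snd I \<and> snd I \<le> length \<tau>) \<and>
     (\<exists>Is. mset Is = B \<and> zigzag_iso \<tau> M (zigzag_sum (map interval_module Is)))"

definition barcode ::
    "direction list \<Rightarrow> ('f::field, 'a) zigzag \<Rightarrow> (nat \<times> nat) multiset" where
  "barcode \<tau> M = (THE B. is_barcode \<tau> M B)"


section \<open>Relative simplicial homology\<close>

definition simplicial_complex :: "'v set set \<Rightarrow> bool" where
  "simplicial_complex K \<longleftrightarrow>
     finite K \<and> (\<forall>\<sigma>\<in>K. finite \<sigma> \<and> \<sigma> \<noteq> {} \<and> (\<forall>\<tau>. \<tau> \<subseteq> \<sigma> \<and> \<tau> \<noteq> {} \<longrightarrow> \<tau> \<in> K))"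

definition chains :: "nat \<Rightarrow> 'v set set \<Rightarrow> ('v set \<Rightarrow> 'f::field) set" where
  "chains k A = {c. \<forall>\<sigma>. c \<sigma> \<noteq> 0 \<longrightarrow> \<sigma> \<in> A \<and> card \<sigma> = Suc k}"

text \<open>Simplices are oriented by the order of the vertices: the face \<open>\<sigma> - {v}\<close> occurs in the
  boundary of \<open>\<sigma>\<close> with the sign given by the position of \<open>v\<close> in \<open>\<sigma>\<close>.  The empty face is
  left out (homology is not reduced), so 0-chains have boundary 0.\<close>

definition bd :: "('v::linorder set \<Rightarrow> 'f::field) \<Rightarrow> 'v set \<Rightarrow> 'f" where
  "bd c = (\<lambda>\<tau>. \<Sum>\<sigma> | c \<sigma> \<noteq> 0. \<Sum>v\<in>\<sigma>.
     if \<sigma> - {v} = \<tau> \<and> \<tau> \<noteq> {} then (-1) ^ card {w\<in>\<sigma>. w < v} * c \<sigma> else 0)"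

text \<open>For \<open>k = 0\<close> the condition on the boundary holds for every chain, as it should, although
  \<open>k - 1\<close> is then 0.\<close>

definition rel_cycles ::
    "nat \<Rightarrow> 'v::linorder set set \<Rightarrow> 'v set set \<Rightarrow> ('f::field, 'v set \<Rightarrow> 'f) module" where
  "rel_cycles k A B =
     \<lparr>carrier = {c \<in> chains k A. bd c \<in> chains (k - 1) B},
      mult = (\<lambda>_ _ _. 0), one = (\<lambda>_. 0), zero = (\<lambda>_. 0),
      add = (\<lambda>c d \<sigma>. c \<sigma> + d \<sigma>), smult = (\<lambda>a c \<sigma>. a * c \<sigma>)\<rparr>"

definition rel_boundaries ::
    "nat \<Rightarrow> 'v::linorder set set \<Rightarrow> 'v set set \<Rightarrow> ('v set \<Rightarrow> 'f::field) set" where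
  "rel_boundaries k A B =
     {(\<lambda>\<sigma>. bd d \<sigma> + b \<sigma>) | d b. d \<in> chains (Suc k) A \<and> b \<in> chains k B}"

definition homology ::
    "nat \<Rightarrow> 'v::linorder set set \<times> 'v set set \<Rightarrow> ('f::field, ('v set \<Rightarrow> 'f) set) module" where
  "homology k X =
     quotient_space (rel_cycles k (fst X) (snd X)) (rel_boundaries k (fst X) (snd X))"

text \<open>The map into the homology of the pair \<open>X\<close> that is induced by the inclusion of a
  pair in \<open>X\<close>.\<close>

definition incl_map ::
    "nat \<Rightarrow> 'v::linorder set set \<times> 'v set set \<Rightarrow>
     ('v set \<Rightarrow> 'f::field) set \<Rightarrow> ('v set \<Rightarrow> 'f) set" where
  "incl_map k X U =
     (\<Union>c\<in>U. rel_boundaries k (fst X) (snd X) +>\<^bsub>rel_cycles k (fst X) (snd X)\<^esub> c)"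

text \<open>A zigzag filtration of type \<open>\<tau>\<close> is given by the list of its pairs.\<close>

definition homology_zigzag ::
    "nat \<Rightarrow> direction list \<Rightarrow> ('v::linorder set set \<times> 'v set set) list \<Rightarrow>
     ('f::field, ('v set \<Rightarrow> 'f) set) zigzag" where
  "homology_zigzag k \<tau> Xs =
     \<lparr>space = (\<lambda>i. homology k (Xs ! i)),
      arrow = (\<lambda>i. case \<tau> ! i of
                Forward \<Rightarrow> incl_map k (Xs ! Suc i)
              | Backward \<Rightarrow> incl_map k (Xs ! i))\<rparr>"


section \<open>Combinatorial dynamics\<close>

definition cl :: "'v set set \<Rightarrow> 'v set set \<Rightarrow> 'v set set" where
  "cl K A = {\<tau>\<in>K. \<exists>\<sigma>\<in>A. \<tau> \<subseteq> \<sigma>}"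

definition mo :: "'v set set \<Rightarrow> 'v set set \<Rightarrow> 'v set set" where
  "mo K A = cl K A - A"

definition closed_in_complex :: "'v set set \<Rightarrow> 'v set set \<Rightarrow> bool" where
  "closed_in_complex K A \<longleftrightarrow> A \<subseteq> K \<and> A = cl K A"

definition multivector :: "'v set set \<Rightarrow> 'v set set \<Rightarrow> bool" where
  "multivector K A \<longleftrightarrow> A \<subseteq> K \<and>
     (\<forall>\<sigma>\<in>A. \<forall>\<tau>\<in>A. \<forall>\<rho>\<in>K. \<sigma> \<subseteq> \<rho> \<and> \<rho> \<subseteq> \<tau> \<longrightarrow> \<rho> \<in> A)"

definition multivector_field :: "'v set set \<Rightarrow> 'v set set set \<Rightarrow> bool" where
  "multivector_field K \<V> \<longleftrightarrow> partition_on K \<V> \<and> (\<forall>V\<in>\<V>. multivector K V)"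

definition mv_of :: "'v set set set \<Rightarrow> 'v set \<Rightarrow> 'v set set" where
  "mv_of \<V> \<sigma> = (THE V. V \<in> \<V> \<and> \<sigma> \<in> V)"

text \<open>The type argument is the coefficient field of the homology; all notions below that depend
  on criticality inherit it.\<close>

definition critical :: "'f::field itself \<Rightarrow> 'v::linorder set set \<Rightarrow> 'v set set \<Rightarrow> bool" where
  "critical F K V \<longleftrightarrow>
     (\<exists>k. let H = (homology k (cl K V, mo K V) :: ('f, ('v set \<Rightarrow> 'f) set) module)
          in carrier H \<noteq> {\<zero>\<^bsub>H\<^esub>})"

definition flow :: "'v set set \<Rightarrow> 'v set set set \<Rightarrow> 'v set set \<Rightarrow> 'v set set" where
  "flow K \<V> A = (\<Union>\<sigma>\<in>A. cl K {\<sigma>} \<union> mv_of \<V> \<sigma>)"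

definition is_path ::
    "'v set set \<Rightarrow> 'v set set set \<Rightarrow> nat \<Rightarrow> (nat \<Rightarrow> 'v set) \<Rightarrow> bool" where
  "is_path K \<V> n \<rho> \<longleftrightarrow> (\<forall>i\<le>n. \<rho> i \<in> K) \<and> (\<forall>i<n. \<rho> (Suc i) \<in> flow K \<V> {\<rho> i})"

definition is_solution ::
    "'v set set \<Rightarrow> 'v set set set \<Rightarrow> (int \<Rightarrow> 'v set) \<Rightarrow> bool" where
  "is_solution K \<V> \<rho> \<longleftrightarrow> (\<forall>i. \<rho> i \<in> K \<and> \<rho> (i + 1) \<in> flow K \<V> {\<rho> i})"

definition is_essential_solution ::
    "'f::field itself \<Rightarrow> 'v::linorder set set \<Rightarrow> 'v set set set \<Rightarrow> (int \<Rightarrow> 'v set) \<Rightarrow> bool" where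
  "is_essential_solution F K \<V> \<rho> \<longleftrightarrow> is_solution K \<V> \<rho> \<and>
     (\<forall>i. \<not> critical F K (mv_of \<V> (\<rho> i)) \<longrightarrow>
        (\<exists>i1 i2. i1 < i \<and> i < i2 \<and>
           mv_of \<V> (\<rho> i1) \<noteq> mv_of \<V> (\<rho> i) \<and> mv_of \<V> (\<rho> i) \<noteq> mv_of \<V> (\<rho> i2)))"

definition Inv ::
    "'f::field itself \<Rightarrow> 'v::linorder set set \<Rightarrow> 'v set set set \<Rightarrow> 'v set set \<Rightarrow> 'v set set" where
  "Inv F K \<V> A =
     {\<sigma>\<in>A. \<exists>\<rho>. is_essential_solution F K \<V> \<rho> \<and> range \<rho> \<subseteq> A \<and> (\<exists>i. \<rho> i = \<sigma>)}"

definition isolated_invariant_set ::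
    "'f::field itself \<Rightarrow> 'v::linorder set set \<Rightarrow> 'v set set set \<Rightarrow> 'v set set \<Rightarrow> bool" where
  "isolated_invariant_set F K \<V> S \<longleftrightarrow> S \<subseteq> K \<and> S = Inv F K \<V> S \<and>
     (\<exists>N. closed_in_complex K N \<and> flow K \<V> S \<subseteq> N \<and>
        (\<forall>n \<rho>. is_path K \<V> n \<rho> \<and> \<rho> ` {..n} \<subseteq> N \<and> \<rho> 0 \<in> S \<and> \<rho> n \<in> S \<longrightarrow> \<rho> ` {..n} \<subseteq> S))"

definition index_pair ::
    "'f::field itself \<Rightarrow> 'v::linorder set set \<Rightarrow> 'v set set set \<Rightarrow> 'v set set \<Rightarrow>
     'v set set \<Rightarrow> 'v set set \<Rightarrow> bool" where
  "index_pair F K \<V> S P E \<longleftrightarrow>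
     closed_in_complex K P \<and> closed_in_complex K E \<and> E \<subseteq> P \<and>
     flow K \<V> (P - E) \<subseteq> P \<and> flow K \<V> E \<inter> P \<subseteq> E \<and> S = Inv F K \<V> (P - E)"

definition push_forward ::
    "'v set set \<Rightarrow> 'v set set set \<Rightarrow> 'v set set \<Rightarrow> 'v set set \<Rightarrow> 'v set set" where
  "push_forward K \<V> A N =
     {\<sigma>\<in>N. \<exists>n \<rho>. is_path K \<V> n \<rho> \<and> \<rho> ` {..n} \<subseteq> N \<and> \<rho> 0 \<in> A \<and> \<rho> n = \<sigma>}"


section \<open>The zigzag filtration of a sequence of connecting index pairs\<close>

definition Q_pair ::
    "'v set set \<Rightarrow> 'v set set set \<Rightarrow> 'v set set \<Rightarrow> 'v set set \<Rightarrow> 'v set set \<times> 'v set set" where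
  "Q_pair K \<V> S P = (push_forward K \<V> (cl K S) P, push_forward K \<V> (mo K S) P)"

definition R_pair ::
    "'v set set \<Rightarrow> 'v set set set \<Rightarrow> 'v set set \<Rightarrow> 'v set set \<Rightarrow> 'v set set \<Rightarrow>
     'v set set \<times> 'v set set" where
  "R_pair K \<V> S P E =
     (P \<inter> push_forward K \<V> (cl K S) P, E \<inter> push_forward K \<V> (mo K S) P)"

definition connecting_filtration ::
    "'v set set \<Rightarrow> (nat \<Rightarrow> 'v set set set) \<Rightarrow> (nat \<Rightarrow> 'v set set) \<Rightarrow>
     (nat \<Rightarrow> 'v set set) \<Rightarrow> (nat \<Rightarrow> 'v set set) \<Rightarrow> nat \<Rightarrow> ('v set set \<times> 'v set set) list" where
  "connecting_filtration K \<V> S P E n =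
     (P 1, E 1) # concat (map (\<lambda>i.
       [R_pair K (\<V> i) (S i) (P (i - 1)) (E (i - 1)),
        Q_pair K (\<V> i) (S i) (P (i - 1)),
        (cl K (S i), mo K (S i)),
        Q_pair K (\<V> i) (S i) (P i),
        R_pair K (\<V> i) (S i) (P i) (E i),
        (P i, E i)]) [2..<Suc n])"

text \<open>Each connection of consecutive index pairs has the shape
  \<open>\<supseteq> \<subseteq> \<supseteq> \<subseteq> \<supseteq> \<subseteq>\<close>.\<close>

definition connecting_type :: "nat \<Rightarrow> direction list" where
  "connecting_type n =
     concat (replicate (n - 1) [Backward, Forward, Backward, Forward, Backward, Forward])"

end

theory Submission
  imports Defs "HOL-Library.Function_Algebras"
begin

text \<open>Every inclusion of pairs in the filtration induces isomorphisms in homology, so all bars are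
  full and their number is the dimension of any one of the spaces.  Consider one connection, with
  \<open>Q1 = pf(cl S, P)\<close> and \<open>Q2 = pf(mo S, P)\<close>.

  A path in \<open>P\<close> that has left \<open>S\<close> does not come back: it would run in \<open>P - E\<close>, since \<open>E\<close> cannot be
  left inside \<open>P\<close>, and would hence extend to an essential solution in \<open>P - E\<close>, whose points lie in
  \<open>S\<close>.  So \<open>Q1 - Q2 = S\<close>, and \<open>(cl S, mo S)\<close> and \<open>(Q1, Q2)\<close> agree up to excision.  The pair
  \<open>(Q1, E \<inter> Q2)\<close> differs from \<open>(Q1, Q2)\<close> by \<open>Q2 - E\<close>, and, up to excision, from \<open>(P, E)\<close> by
  \<open>P - (Q1 \<union> E)\<close>.  Both sets are unions of multivectors that contain no essential solution,
  and such sets do not contribute to relative homology.\<close>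

section \<open>Chains and boundaries\<close>

text \<open>All homology is reduced to one criterion, proved by correcting chains by hand: the
  inclusion of (A, B) in (A', B') is an isomorphism if the relative homology of (A', A \<union> B')
  and of (A \<inter> B', B) vanishes. For (cl S, mo S) in (Q1, Q2) both of these pairs consist of
  equal sets; for (Q1, E \<inter> Q2) the second carries the content when the target is (Q1, Q2),
  and the first when it is (P, E). The obstacle on the dynamical side is that essential solutions
  are two-sided, while paths only give pieces of them. Membership in S is therefore split into a
  past and a future in P - E, each of which is passed along a single flow step. The barcode is a
  definite description, so uniqueness of the decomposition has to be shown as well. Here all arrows
  are invertible, so every bar is full, and the number of bars is determined by the cardinality of
  one space, which is finite because the coefficient field is.\<close>

lemma zero_in_chains [simp, intro]: "0 \<in> chains k A"
  by (simp add: chains_def)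

lemma chains_add [intro]: "c \<in> chains k A \<Longrightarrow> d \<in> chains k A \<Longrightarrow> c + d \<in> chains k A"
  by (clarsimp simp: chains_def plus_fun_def) (metis add_0)

lemma chains_smult [intro]: "c \<in> chains k A \<Longrightarrow> (\<lambda>\<sigma>. a * c \<sigma>) \<in> chains k A"
  unfolding chains_def by auto

lemma chains_uminus [intro]: "c \<in> chains k A \<Longrightarrow> - c \<in> chains k A"
  unfolding chains_def by (auto simp: fun_Compl_def)

lemma chains_diff [intro]: "c \<in> chains k A \<Longrightarrow> d \<in> chains k A \<Longrightarrow> c - d \<in> chains k A"
  using chains_add[of c k A "- d"] chains_uminus[of d k A] by simp

lemma chains_mono: "A \<subseteq> B \<Longrightarrow> chains k A \<subseteq> chains k B"
  unfolding chains_def by auto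

lemma chains_Int: "c \<in> chains k A \<Longrightarrow> c \<in> chains k B \<Longrightarrow> c \<in> chains k (A \<inter> B)"
  unfolding chains_def by auto

lemma chains_Un_split:
  assumes "c \<in> chains k (A \<union> B)"
  obtains a b where "a \<in> chains k A" "b \<in> chains k B" "c = a + b"
proof
  show "(\<lambda>\<sigma>. if \<sigma> \<in> A then c \<sigma> else 0) \<in> chains k A"
    and "(\<lambda>\<sigma>. if \<sigma> \<in> A then 0 else c \<sigma>) \<in> chains k B"
    using assms unfolding chains_def by (auto split: if_splits)
qed (auto simp: plus_fun_def)

text \<open>A finite coefficient field makes the homology spaces finite sets; their finite dimension
  and the count of the bars are both drawn from this.\<close>

lemma finite_chains:
  assumes "finite A"
  shows "finite (chains k A :: ('v set \<Rightarrow> 'f::{field,finite}) set)"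
proof (rule finite_subset)
  show "(chains k A :: ('v set \<Rightarrow> 'f) set) \<subseteq> {c. \<forall>\<sigma>. (\<sigma> \<in> A \<longrightarrow> c \<sigma> \<in> UNIV) \<and> (\<sigma> \<notin> A \<longrightarrow> c \<sigma> = 0)}"
    unfolding chains_def by auto
qed (intro finite_set_of_finite_funs assms, simp)

text \<open>The entries of the boundary matrix. They allow a sum over one fixed finite set of
  simplices, whereas \<open>bd\<close> sums over the support of the chain, which changes under
  addition.\<close>

definition incidence :: "'v::linorder set \<Rightarrow> 'v set \<Rightarrow> 'f::field" where
  "incidence \<sigma> \<tau> =
     (\<Sum>v\<in>\<sigma>. if \<sigma> - {v} = \<tau> \<and> \<tau> \<noteq> {} then (-1) ^ card {w\<in>\<sigma>. w < v} else 0)"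

lemma bd_eq_sum_incidence:
  assumes "finite A" and "c \<in> chains k A"
  shows "bd c \<tau> = (\<Sum>\<sigma>\<in>A. incidence \<sigma> \<tau> * c \<sigma>)"
proof -
  have "bd c \<tau> = (\<Sum>\<sigma> | c \<sigma> \<noteq> 0. incidence \<sigma> \<tau> * c \<sigma>)"
    unfolding bd_def incidence_def sum_distrib_right by (intro sum.cong) (auto split: if_splits)
  also have "\<dots> = (\<Sum>\<sigma>\<in>A. incidence \<sigma> \<tau> * c \<sigma>)"
    using assms by (intro sum.mono_neutral_left) (auto simp: chains_def)
  finally show ?thesis .
qed

lemma bd_add:
  assumes "finite A" "c \<in> chains k A" "d \<in> chains k A"
  shows "bd (c + d) = bd c + bd d"
proof (rule ext)
  fix \<tau>
  show "bd (c + d) \<tau> = (bd c + bd d) \<tau>"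
    unfolding plus_fun_apply bd_eq_sum_incidence[OF assms(1) chains_add[OF assms(2,3)]]
      bd_eq_sum_incidence[OF assms(1,2)] bd_eq_sum_incidence[OF assms(1,3)]
    by (simp add: distrib_left sum.distrib)
qed

lemma bd_smult:
  assumes "finite A" "c \<in> chains k A"
  shows "bd (\<lambda>\<sigma>. a * c \<sigma>) = (\<lambda>\<tau>. a * bd c \<tau>)"
proof (rule ext)
  fix \<tau>
  show "bd (\<lambda>\<sigma>. a * c \<sigma>) \<tau> = a * bd c \<tau>"
    unfolding bd_eq_sum_incidence[OF assms(1) chains_smult[OF assms(2)]]
      bd_eq_sum_incidence[OF assms(1,2)]
    by (simp add: sum_distrib_left mult.left_commute)
qed

lemma bd_zero [simp]: "bd 0 = 0"
  by (rule ext) (simp add: bd_def)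

lemma bd_diff:
  assumes "finite A" "c \<in> chains k A" "d \<in> chains k A"
  shows "bd (c - d) = bd c - bd d"
proof -
  have "bd (c - d) + bd d = bd (c - d + d)"
    using bd_add[OF assms(1) chains_diff[OF assms(2,3)] assms(3)] by simp
  then show ?thesis by (simp add: algebra_simps)
qed

lemma incidence_nonzero:
  assumes "(incidence \<sigma> \<tau> :: 'f::field) \<noteq> 0"
  shows "\<tau> \<subseteq> \<sigma> \<and> \<tau> \<noteq> {} \<and> finite \<sigma> \<and> card \<sigma> = Suc (card \<tau>)"
proof -
  have "finite \<sigma>"
    using assms by (rule contrapos_np) (simp add: incidence_def)
  moreover obtain v where "v \<in> \<sigma>"
    "(if \<sigma> - {v} = \<tau> \<and> \<tau> \<noteq> {} then (-1) ^ card {w\<in>\<sigma>. w < v} else 0 :: 'f) \<noteq> 0"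
    using assms unfolding incidence_def by (rule sum.not_neutral_contains_not_neutral)
  then have "v \<in> \<sigma>" "\<sigma> - {v} = \<tau>" "\<tau> \<noteq> {}" by (auto split: if_splits)
  ultimately show ?thesis using card.remove[of \<sigma> v] by auto
qed

text \<open>The term at (v, w) is paired with the one at (w, v) by exchanging the sums over the half
  w < v. Deriving s = - s for the total s would say nothing in characteristic two.\<close>

lemma sum_antisymmetric_pairs:
  fixes g :: "'v::linorder \<Rightarrow> 'v \<Rightarrow> 'a::ab_group_add"
  assumes "finite A" and g: "\<And>v w. v \<in> A \<Longrightarrow> w \<in> A \<Longrightarrow> v < w \<Longrightarrow> g v w + g w v = 0"
  shows "(\<Sum>v\<in>A. \<Sum>w\<in>A - {v}. g v w) = 0"
proof -
  have "(\<Sum>w\<in>A - {v}. g v w) = (\<Sum>w | w \<in> A \<and> v < w. g v w) + (\<Sum>w | w \<in> A \<and> w < v. g v w)" for v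
  proof -
    have "A - {v} = {w. w \<in> A \<and> v < w} \<union> {w. w \<in> A \<and> w < v}" by auto
    moreover have "{w. w \<in> A \<and> v < w} \<inter> {w. w \<in> A \<and> w < v} = {}" by auto
    ultimately show ?thesis using assms(1) by (simp add: sum.union_disjoint)
  qed
  then have "(\<Sum>v\<in>A. \<Sum>w\<in>A - {v}. g v w) =
      (\<Sum>v\<in>A. \<Sum>w | w \<in> A \<and> v < w. g v w) + (\<Sum>v\<in>A. \<Sum>w | w \<in> A \<and> w < v. g v w)"
    by (simp add: sum.distrib)
  also have "(\<Sum>v\<in>A. \<Sum>w | w \<in> A \<and> w < v. g v w) = (\<Sum>w\<in>A. \<Sum>v | v \<in> A \<and> w < v. g v w)"
    by (rule sum.swap_restrict[OF assms(1,1)])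
  also have "(\<Sum>v\<in>A. \<Sum>w | w \<in> A \<and> v < w. g v w) + \<dots> =
      (\<Sum>v\<in>A. \<Sum>w | w \<in> A \<and> v < w. g v w + g w v)"
    by (simp add: sum.distrib)
  also have "\<dots> = 0"
    using g by (intro sum.neutral ballI) auto
  finally show ?thesis .
qed

text \<open>The matrix form of the vanishing of \<open>bd\<close> after \<open>bd\<close>: terms
  correspond to deleting two vertices one after the other, and the two orders carry opposite signs.
  The set A contains the nonempty faces of \<sigma> so that every intermediate face is met by the
  sum.\<close>

lemma sum_incidence_incidence:
  assumes "finite \<sigma>" "finite A" and faces: "\<And>\<tau>. \<tau> \<subseteq> \<sigma> \<Longrightarrow> \<tau> \<noteq> {} \<Longrightarrow> \<tau> \<in> A"
  shows "(\<Sum>\<tau>\<in>A. incidence \<tau> \<rho> * (incidence \<sigma> \<tau> :: 'f::field)) = 0"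
proof (cases "\<rho> = {}")
  case True
  then show ?thesis by (simp add: incidence_def)
next
  case False
  define s :: "'a set \<Rightarrow> 'a \<Rightarrow> 'f" where "s \<alpha> v = (-1) ^ card {w\<in>\<alpha>. w < v}" for \<alpha> v
  define g where "g v w = (if \<sigma> - {v} - {w} = \<rho> then s \<sigma> v * s (\<sigma> - {v}) w else 0)" for v w
  have "(\<Sum>\<tau>\<in>A. incidence \<tau> \<rho> * (incidence \<sigma> \<tau> :: 'f)) =
      (\<Sum>v\<in>\<sigma>. \<Sum>\<tau>\<in>A. if \<sigma> - {v} = \<tau> then (if \<tau> \<noteq> {} then incidence \<tau> \<rho> * s \<sigma> v else 0) else 0)"
    unfolding incidence_def[of \<sigma>] sum_distrib_left
    by (subst sum.swap) (intro sum.cong refl, simp add: s_def)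
  also have "\<dots> = (\<Sum>v\<in>\<sigma>. s \<sigma> v * incidence (\<sigma> - {v}) \<rho>)"
  proof (rule sum.cong[OF refl])
    fix v assume "v \<in> \<sigma>"
    show "(\<Sum>\<tau>\<in>A. if \<sigma> - {v} = \<tau> then (if \<tau> \<noteq> {} then incidence \<tau> \<rho> * s \<sigma> v else 0) else 0)
      = s \<sigma> v * incidence (\<sigma> - {v}) \<rho>"
    \<comment> \<open>Deleting the only vertex gives the empty face, which counts as zero on both
      sides.\<close>
    proof (cases "\<sigma> - {v} = {}")
      case True
      then show ?thesis unfolding True by (simp add: incidence_def)
    next
      case False
      then have "\<sigma> - {v} \<in> A" by (intro faces) auto
      then show ?thesis using assms(2) False by simp
    qed
  qed
  also have "\<dots> = (\<Sum>v\<in>\<sigma>. \<Sum>w\<in>\<sigma> - {v}. g v w)"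
    unfolding incidence_def sum_distrib_left using False
    by (intro sum.cong refl) (simp add: g_def s_def)
  also have "\<dots> = 0"
  proof (rule sum_antisymmetric_pairs[OF assms(1)])
    fix v w assume vw: "v \<in> \<sigma>" "w \<in> \<sigma>" "v < w"
    \<comment> \<open>Deleting the smaller vertex v first lowers the position of w by one and flips
      its sign; deleting w first leaves the position of v as it was.\<close>
    have "{x \<in> \<sigma>. x < w} = insert v {x \<in> \<sigma> - {v}. x < w}" using vw by auto
    then have "s \<sigma> w = - s (\<sigma> - {v}) w"
      unfolding s_def using assms(1) by simp
    moreover have "{x \<in> \<sigma> - {w}. x < v} = {x \<in> \<sigma>. x < v}" using vw by auto
    then have "s (\<sigma> - {w}) v = s \<sigma> v" unfolding s_def by simp
    moreover have "\<sigma> - {v} - {w} = \<sigma> - {w} - {v}" by auto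
    ultimately show "g v w + g w v = 0" unfolding g_def by simp
  qed
  finally show ?thesis .
qed

section \<open>Closed subsets of the complex\<close>

lemma closed_in_complex_iff:
  "closed_in_complex K A \<longleftrightarrow> A \<subseteq> K \<and> (\<forall>\<sigma>\<in>A. \<forall>\<tau>\<in>K. \<tau> \<subseteq> \<sigma> \<longrightarrow> \<tau> \<in> A)"
  unfolding closed_in_complex_def cl_def by auto

lemma closed_in_complex_face:
  "closed_in_complex K A \<Longrightarrow> \<sigma> \<in> A \<Longrightarrow> \<tau> \<in> K \<Longrightarrow> \<tau> \<subseteq> \<sigma> \<Longrightarrow> \<tau> \<in> A"
  by (auto simp: closed_in_complex_iff)

lemma closed_in_complexI:
  "A \<subseteq> K \<Longrightarrow> (\<And>\<sigma> \<tau>. \<sigma> \<in> A \<Longrightarrow> \<tau> \<in> K \<Longrightarrow> \<tau> \<subseteq> \<sigma> \<Longrightarrow> \<tau> \<in> A) \<Longrightarrow> closed_in_complex K A"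
  by (simp add: closed_in_complex_iff)

lemma closed_in_complex_subset: "closed_in_complex K A \<Longrightarrow> A \<subseteq> K"
  by (simp add: closed_in_complex_iff)

lemma closed_in_complex_Un:
  "closed_in_complex K A \<Longrightarrow> closed_in_complex K B \<Longrightarrow> closed_in_complex K (A \<union> B)"
  by (auto simp: closed_in_complex_iff)

lemma closed_in_complex_Int:
  "closed_in_complex K A \<Longrightarrow> closed_in_complex K B \<Longrightarrow> closed_in_complex K (A \<inter> B)"
  by (auto simp: closed_in_complex_iff)

lemma closed_in_complex_cl: "closed_in_complex K (cl K A)"
  by (auto simp: closed_in_complex_iff cl_def)

locale complex_on =
  fixes K :: "'v::linorder set set"
  assumes complex: "simplicial_complex K"
begin

lemma finite_K: "finite K"
  using complex by (simp add: simplicial_complex_def)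

lemma closed_finite: "closed_in_complex K A \<Longrightarrow> finite A"
  using finite_K finite_subset closed_in_complex_subset by blast

lemma simplex_finite: "\<sigma> \<in> K \<Longrightarrow> finite \<sigma>"
  using complex by (simp add: simplicial_complex_def)

lemma face_in_K: "\<sigma> \<in> K \<Longrightarrow> \<tau> \<subseteq> \<sigma> \<Longrightarrow> \<tau> \<noteq> {} \<Longrightarrow> \<tau> \<in> K"
  using complex unfolding simplicial_complex_def by metis

lemma bd_in_chains:
  fixes c :: "'v set \<Rightarrow> 'f::field"
  assumes "closed_in_complex K A" "c \<in> chains k A"
  shows "bd c \<in> chains (k - 1) A"
  unfolding chains_def
proof (intro CollectI allI impI)
  fix \<tau> assume "bd c \<tau> \<noteq> 0"
  then have "(\<Sum>\<sigma>\<in>A. incidence \<sigma> \<tau> * c \<sigma>) \<noteq> 0"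
    by (simp add: bd_eq_sum_incidence[OF closed_finite[OF assms(1)] assms(2)])
  then obtain \<sigma> where "\<sigma> \<in> A" "incidence \<sigma> \<tau> * c \<sigma> \<noteq> 0"
    by (rule sum.not_neutral_contains_not_neutral)
  then have \<sigma>: "\<sigma> \<in> A" "(incidence \<sigma> \<tau> :: 'f) \<noteq> 0" "c \<sigma> \<noteq> 0" by auto
  then have card: "card \<sigma> = Suc k" using assms(2) by (auto simp: chains_def)
  have \<tau>: "\<tau> \<subseteq> \<sigma>" "\<tau> \<noteq> {}" "finite \<sigma>" "card \<sigma> = Suc (card \<tau>)"
    using incidence_nonzero[OF \<sigma>(2)] by auto
  \<comment> \<open>A nonempty face of codimension one forces k to be positive, so the truncated
    \<open>k - 1\<close> is the true degree.\<close>
  then have "card \<tau> > 0" by (meson card_gt_0_iff finite_subset)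
  moreover have "\<tau> \<in> A"
    using \<sigma> \<tau> face_in_K closed_in_complex_face[OF assms(1)] closed_in_complex_subset[OF assms(1)]
    by blast
  ultimately show "\<tau> \<in> A \<and> card \<tau> = Suc (k - 1)" using card \<tau> by simp
qed

text \<open>Takes care of \<open>k - 1\<close> at \<open>k = 0\<close>: the only face of codimension
  one of a vertex is empty, and \<open>incidence\<close> excludes it.\<close>

lemma bd_chains_0:
  fixes c :: "'v set \<Rightarrow> 'f::field"
  assumes "A \<subseteq> K" "c \<in> chains 0 A"
  shows "bd c = 0"
proof (rule ext)
  fix \<tau>
  have "incidence \<sigma> \<tau> * c \<sigma> = 0" for \<sigma>
  proof (rule ccontr)
    assume "incidence \<sigma> \<tau> * c \<sigma> \<noteq> 0"
    then have "(incidence \<sigma> \<tau> :: 'f) \<noteq> 0" "card \<sigma> = Suc 0"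
      using assms(2) by (auto simp: chains_def)
    with incidence_nonzero[OF this(1)] show False by (auto dest: finite_subset)
  qed
  then show "bd c \<tau> = 0 \<tau>"
    by (simp add: bd_eq_sum_incidence[OF finite_subset[OF assms(1) finite_K] assms(2)])
qed

lemma bd_bd:
  fixes c :: "'v set \<Rightarrow> 'f::field"
  assumes "A \<subseteq> K" "c \<in> chains k A"
  shows "bd (bd c) = 0"
proof (rule ext)
  fix \<rho>
  have K: "closed_in_complex K K" by (rule closed_in_complexI) auto
  have c: "c \<in> chains k K" by (rule subsetD[OF chains_mono[OF assms(1)] assms(2)])
  have "bd (bd c) \<rho> = (\<Sum>\<tau>\<in>K. incidence \<tau> \<rho> * (\<Sum>\<sigma>\<in>K. incidence \<sigma> \<tau> * c \<sigma>))"
    unfolding bd_eq_sum_incidence[OF finite_K bd_in_chains[OF K c]]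
      bd_eq_sum_incidence[OF finite_K c] by (rule refl)
  also have "\<dots> = (\<Sum>\<sigma>\<in>K. (\<Sum>\<tau>\<in>K. incidence \<tau> \<rho> * incidence \<sigma> \<tau>) * c \<sigma>)"
    unfolding sum_distrib_left sum_distrib_right mult.assoc by (rule sum.swap)
  also have "\<dots> = 0"
  proof (intro sum.neutral ballI)
    fix \<sigma> assume \<sigma>: "\<sigma> \<in> K"
    have "(\<Sum>\<tau>\<in>K. incidence \<tau> \<rho> * (incidence \<sigma> \<tau> :: 'f)) = 0"
      by (rule sum_incidence_incidence[OF simplex_finite[OF \<sigma>] finite_K face_in_K[OF \<sigma>]])
    then show "(\<Sum>\<tau>\<in>K. incidence \<tau> \<rho> * incidence \<sigma> \<tau>) * c \<sigma> = 0" by simp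
  qed
  finally show "bd (bd c) \<rho> = 0 \<rho>" by simp
qed

end

section \<open>Relative homology as a space of classes\<close>

lemma linear_mapI:
  assumes "vectorspace class_ring V" "vectorspace class_ring W"
    and "\<And>x. x \<in> carrier V \<Longrightarrow> f x \<in> carrier W"
    and "\<And>x y. x \<in> carrier V \<Longrightarrow> y \<in> carrier V \<Longrightarrow> f (x \<oplus>\<^bsub>V\<^esub> y) = f x \<oplus>\<^bsub>W\<^esub> f y"
    and "\<And>a x. x \<in> carrier V \<Longrightarrow> f (a \<odot>\<^bsub>V\<^esub> x) = a \<odot>\<^bsub>W\<^esub> f x"
  shows "linear_map class_ring V W f"
proof -
  have "f \<in> LinearCombinations.module_hom class_ring V W"
    using assms(3-5) unfolding LinearCombinations.module_hom_def by blast
  then show ?thesis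
    using assms(1,2) by (simp add: linear_map_def mod_hom_def mod_hom_axioms_def vectorspace_def)
qed

text \<open>A constant in place of a lambda term, so that \<open>scale_simps\<close> can be used
  like the laws of a vector space next to the pointwise sum and difference of functions.\<close>

definition scale :: "'f::field \<Rightarrow> ('a \<Rightarrow> 'f) \<Rightarrow> 'a \<Rightarrow> 'f" where
  "scale a c = (\<lambda>\<sigma>. a * c \<sigma>)"

lemma scale_simps:
  "scale a (c + d) = scale a c + scale a d" "scale a (c - d) = scale a c - scale a d"
  "scale (a + b) c = scale a c + scale b c" "scale (a * b) c = scale a (scale b c)"
  "scale 1 c = c"
  by (auto simp: scale_def fun_eq_iff algebra_simps)

lemma scale_in_chains [intro]: "c \<in> chains k A \<Longrightarrow> scale a c \<in> chains k A"
  unfolding scale_def by (rule chains_smult)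

lemma rel_cycles_simps:
  "c \<in> carrier (rel_cycles k A B) \<longleftrightarrow> c \<in> chains k A \<and> bd c \<in> chains (k - 1) B"
  "add (rel_cycles k A B) = (+)" "zero (rel_cycles k A B) = 0" "smult (rel_cycles k A B) = scale"
  unfolding rel_cycles_def by (auto simp: fun_eq_iff scale_def)

lemma rel_boundaries_iff:
  "c \<in> rel_boundaries k A B \<longleftrightarrow> (\<exists>d b. d \<in> chains (Suc k) A \<and> b \<in> chains k B \<and> c = bd d + b)"
  unfolding rel_boundaries_def plus_fun_def mem_Collect_eq by metis

lemma rel_boundariesI:
  "d \<in> chains (Suc k) A \<Longrightarrow> b \<in> chains k B \<Longrightarrow> c = bd d + b \<Longrightarrow> c \<in> rel_boundaries k A B"
  unfolding rel_boundaries_iff by (intro exI conjI)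

lemma rel_boundariesE:
  assumes "c \<in> rel_boundaries k A B"
  obtains d b where "d \<in> chains (Suc k) A" "b \<in> chains k B" "c = bd d + b"
  using assms unfolding rel_boundaries_iff by (elim exE conjE)

lemma chains_monoD: "c \<in> chains k A \<Longrightarrow> A \<subseteq> B \<Longrightarrow> c \<in> chains k B"
  using chains_mono by (rule subsetD)

lemma rel_boundaries_mono:
  assumes "A \<subseteq> A'" "B \<subseteq> B'"
  shows "rel_boundaries k A B \<subseteq> (rel_boundaries k A' B' :: ('v::linorder set \<Rightarrow> 'f::field) set)"
proof
  fix c :: "'v set \<Rightarrow> 'f" assume "c \<in> rel_boundaries k A B"
  then obtain d b where "d \<in> chains (Suc k) A" "b \<in> chains k B" "c = bd d + b"
    by (rule rel_boundariesE)
  then show "c \<in> rel_boundaries k A' B'"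
    by (intro rel_boundariesI chains_monoD[OF _ assms(1)] chains_monoD[OF _ assms(2)])
qed

lemma rel_cycles_mono:
  assumes "A \<subseteq> A'" "B \<subseteq> B'"
  shows "carrier (rel_cycles k A B) \<subseteq>
    carrier (rel_cycles k A' B' :: ('f::field, 'v::linorder set \<Rightarrow> 'f) module)"
proof
  fix c :: "'v set \<Rightarrow> 'f" assume "c \<in> carrier (rel_cycles k A B)"
  then have "c \<in> chains k A" "bd c \<in> chains (k - 1) B" by (simp_all add: rel_cycles_simps)
  from this[THEN chains_monoD] assms show "c \<in> carrier (rel_cycles k A' B')"
    by (simp add: rel_cycles_simps)
qed

definition closed_pair :: "'v set set \<Rightarrow> 'v set set \<times> 'v set set \<Rightarrow> bool" where
  "closed_pair K X \<longleftrightarrow>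
     closed_in_complex K (fst X) \<and> closed_in_complex K (snd X) \<and> snd X \<subseteq> fst X"

text \<open>The coset of c, formed for arbitrary functions c and not only for relative cycles.
  Membership then means just that a difference is a relative boundary.\<close>

definition hclass :: "nat \<Rightarrow> 'v::linorder set set \<times> 'v set set \<Rightarrow> ('v set \<Rightarrow> 'f::field) \<Rightarrow>
    ('v set \<Rightarrow> 'f) set" where
  "hclass k X c = (\<lambda>w. w + c) ` rel_boundaries k (fst X) (snd X)"

lemma hclass_iff: "u \<in> hclass k X c \<longleftrightarrow> u - c \<in> rel_boundaries k (fst X) (snd X)"
proof
  assume "u - c \<in> rel_boundaries k (fst X) (snd X)"
  then show "u \<in> hclass k X c" unfolding hclass_def by (rule image_eqI[rotated]) simp
qed (auto simp: hclass_def)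

lemma hclass_eq_coset:
  "rel_boundaries k (fst X) (snd X) +>\<^bsub>rel_cycles k (fst X) (snd X)\<^esub> c = hclass k X c"
  unfolding a_r_coset_def' rel_cycles_simps hclass_def by auto

lemma homology_simps:
  "carrier (homology k X) = hclass k X ` carrier (rel_cycles k (fst X) (snd X))"
  "zero (homology k X) = rel_boundaries k (fst X) (snd X)"
  "add (homology k X) U V = {u + v | u v. u \<in> U \<and> v \<in> V}"
  "smult (homology k X) a U = (\<Union>c\<in>U. hclass k X (scale a c))"
  unfolding homology_def quotient_space_def A_RCOSETS_def' hclass_eq_coset set_add_def'
  by (auto simp: rel_cycles_simps hclass_eq_coset)

context complex_on
begin

lemma rel_boundaries_zero: "0 \<in> rel_boundaries k A B"
  by (rule rel_boundariesI[of 0 _ _ 0]) simp_all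

lemma rel_boundaries_diff:
  assumes "closed_in_complex K A" "c \<in> rel_boundaries k A B" "d \<in> rel_boundaries k A B"
  shows "c - d \<in> rel_boundaries k A B"
proof -
  from assms(2,3) obtain x b y b' where
    *: "x \<in> chains (Suc k) A" "b \<in> chains k B" "c = bd x + b"
       "y \<in> chains (Suc k) A" "b' \<in> chains k B" "d = bd y + b'"
    by (elim rel_boundariesE)
  then have "c - d = bd (x - y) + (b - b')"
    using bd_diff[OF closed_finite[OF assms(1)] *(1,4)] by simp
  with chains_diff[OF *(1,4)] chains_diff[OF *(2,5)] show ?thesis by (rule rel_boundariesI)
qed

lemma rel_boundaries_add:
  assumes "closed_in_complex K A" "c \<in> rel_boundaries k A B" "d \<in> rel_boundaries k A B"
  shows "c + d \<in> rel_boundaries k A B"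
proof -
  have "0 - d \<in> rel_boundaries k A B"
    using rel_boundaries_diff[OF assms(1) rel_boundaries_zero assms(3)] .
  from rel_boundaries_diff[OF assms(1,2) this] show ?thesis by simp
qed

lemma rel_boundaries_scale:
  assumes "closed_in_complex K A" "c \<in> rel_boundaries k A B"
  shows "scale a c \<in> rel_boundaries k A B"
proof -
  from assms(2) obtain x b where
    *: "x \<in> chains (Suc k) A" "b \<in> chains k B" "c = bd x + b"
    by (elim rel_boundariesE)
  then have "scale a c = bd (scale a x) + scale a b"
    using bd_smult[OF closed_finite[OF assms(1)] *(1)] by (simp add: scale_simps) (simp add: scale_def)
  with scale_in_chains[OF *(1)] scale_in_chains[OF *(2)] show ?thesis by (rule rel_boundariesI)
qed

lemma rel_cycles_zero: "0 \<in> carrier (rel_cycles k A B)"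
  by (simp add: rel_cycles_simps)

lemma rel_cycles_add:
  assumes "closed_in_complex K A" "c \<in> carrier (rel_cycles k A B)" "d \<in> carrier (rel_cycles k A B)"
  shows "c + d \<in> carrier (rel_cycles k A B)"
  using assms bd_add[OF closed_finite[OF assms(1)], of c k d]
  by (auto simp: rel_cycles_simps)

lemma rel_cycles_scale:
  assumes "closed_in_complex K A" "c \<in> carrier (rel_cycles k A B)"
  shows "scale a c \<in> carrier (rel_cycles k A B)"
  using assms bd_smult[OF closed_finite[OF assms(1)], of c k a]
  by (auto simp: rel_cycles_simps scale_def intro: chains_smult)

lemma hclass_self: "c \<in> hclass k X c"
  by (simp add: hclass_iff rel_boundaries_zero)

lemma hclass_eq_iff:
  assumes "closed_pair K X"
  shows "hclass k X c = hclass k X d \<longleftrightarrow> c - d \<in> rel_boundaries k (fst X) (snd X)"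
proof
  assume "hclass k X c = hclass k X d"
  then have "c \<in> hclass k X d" by (simp add: hclass_self flip: \<open>hclass k X c = hclass k X d\<close>)
  then show "c - d \<in> rel_boundaries k (fst X) (snd X)" by (simp only: hclass_iff)
next
  have closed: "closed_in_complex K (fst X)" using assms by (simp add: closed_pair_def)
  assume cd: "c - d \<in> rel_boundaries k (fst X) (snd X)"
  have "u - c \<in> rel_boundaries k (fst X) (snd X) \<longleftrightarrow> u - d \<in> rel_boundaries k (fst X) (snd X)" for u
    using rel_boundaries_add[OF closed _ cd, of "u - c"] rel_boundaries_diff[OF closed _ cd, of "u - d"]
    by auto
  then show "hclass k X c = hclass k X d" by (intro Set.set_eqI) (simp only: hclass_iff)
qed

lemma hclass_add:
  assumes "closed_pair K X"
  shows "hclass k X c \<oplus>\<^bsub>homology k X\<^esub> hclass k X d = hclass k X (c + d)"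
proof (intro subset_antisym subsetI)
  have closed: "closed_in_complex K (fst X)" using assms by (simp add: closed_pair_def)
  fix x assume "x \<in> hclass k X c \<oplus>\<^bsub>homology k X\<^esub> hclass k X d"
  then obtain u v where uv: "x = u + v" "u - c \<in> rel_boundaries k (fst X) (snd X)"
    "v - d \<in> rel_boundaries k (fst X) (snd X)"
    unfolding homology_simps hclass_iff mem_Collect_eq by (elim exE conjE)
  then have "x - (c + d) = (u - c) + (v - d)" by simp
  then show "x \<in> hclass k X (c + d)"
    by (simp only: hclass_iff rel_boundaries_add[OF closed uv(2,3)])
next
  fix x assume "x \<in> hclass k X (c + d)"
  then have "x = (x - d) + d" "x - d \<in> hclass k X c" "d \<in> hclass k X d"
    by (simp_all add: hclass_self) (simp add: hclass_iff algebra_simps)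
  then show "x \<in> hclass k X c \<oplus>\<^bsub>homology k X\<^esub> hclass k X d"
    unfolding homology_simps mem_Collect_eq by (intro exI conjI)
qed

text \<open>The union in \<open>quotient_space\<close> collects one coset per representative; all of
  them agree since relative boundaries are closed under scaling.\<close>

lemma hclass_scale:
  assumes "closed_pair K X"
  shows "a \<odot>\<^bsub>homology k X\<^esub> hclass k X c = hclass k X (scale a c)"
proof -
  have closed: "closed_in_complex K (fst X)" using assms by (simp add: closed_pair_def)
  have "hclass k X (scale a (w + c)) = hclass k X (scale a c)"
    if "w \<in> rel_boundaries k (fst X) (snd X)" for w
    unfolding hclass_eq_iff[OF assms] using rel_boundaries_scale[OF closed that]
    by (simp add: scale_simps)
  then have "hclass k X (scale a x) = hclass k X (scale a c)" if "x \<in> hclass k X c" for x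
    using that unfolding hclass_def by auto
  then have "smult (homology k X) a (hclass k X c) = (\<Union>x\<in>hclass k X c. hclass k X (scale a c))"
    unfolding homology_simps by (intro SUP_cong refl)
  also have "\<dots> = hclass k X (scale a c)" using hclass_self[of c k X] by auto
  finally show ?thesis .
qed

lemma homology_zero: "\<zero>\<^bsub>homology k X\<^esub> = hclass k X 0"
  by (simp add: homology_simps hclass_def)

lemma homology_vectorspace:
  assumes "closed_pair K X"
  shows "vectorspace class_ring (homology k X :: ('f::field, ('v set \<Rightarrow> 'f) set) module)"
proof -
  have closed: "closed_in_complex K (fst X)" using assms by (simp add: closed_pair_def)
  note simps = hclass_add[OF assms] hclass_scale[OF assms] homology_zero homology_simps(1)
  have neg: "c + scale (- 1) c = 0" for c :: "'v set \<Rightarrow> 'f"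
    by (auto simp: scale_def fun_eq_iff)
  show ?thesis
  proof (rule vs_criteria, goal_cases)
    case 1
    then show ?case by (rule class_field)
  next
    case 2
    then show ?case by (auto simp: simps rel_cycles_zero)
  next
    case 3
    then show ?case by (auto simp: simps rel_cycles_add[OF closed])
  next
    case 4
    then show ?case
    proof
      fix v assume "v \<in> carrier (homology k X :: ('f, ('v set \<Rightarrow> 'f) set) module)"
      then obtain c where c: "c \<in> carrier (rel_cycles k (fst X) (snd X))" "v = hclass k X c"
        by (auto simp: simps)
      show "\<exists>neg_v\<in>carrier (homology k X). v \<oplus>\<^bsub>homology k X\<^esub> neg_v = \<zero>\<^bsub>homology k X\<^esub>"
      proof
        show "hclass k X (scale (- 1) c) \<in> carrier (homology k X)"
          using rel_cycles_scale[OF closed c(1)] by (simp add: simps)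
        show "v \<oplus>\<^bsub>homology k X\<^esub> hclass k X (scale (- 1) c) = \<zero>\<^bsub>homology k X\<^esub>"
          by (simp add: simps c(2) neg)
      qed
    qed
  next
    case 5
    then show ?case by (auto simp: simps rel_cycles_scale[OF closed])
  qed (auto simp: simps scale_simps add_ac)
qed

lemma finite_homology:
  assumes "closed_pair K X"
  shows "finite (carrier (homology k X :: ('f::{field,finite}, ('v set \<Rightarrow> 'f) set) module))"
proof -
  have "finite (fst X)" using assms closed_finite by (simp add: closed_pair_def)
  then have "finite (carrier (rel_cycles k (fst X) (snd X) :: ('f, 'v set \<Rightarrow> 'f) module))"
    by (rule finite_subset[rotated, OF finite_chains[of _ k]]) (auto simp: rel_cycles_simps)
  then show ?thesis by (simp add: homology_simps)
qed

text \<open>Representatives of one class differ by boundaries of the smaller pair, which are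
  boundaries of the larger pair as well, so the union in \<open>incl_map\<close> is a single
  coset.\<close>

lemma incl_map_hclass:
  assumes "closed_pair K Y" "fst X \<subseteq> fst Y" "snd X \<subseteq> snd Y"
  shows "incl_map k Y (hclass k X c) = hclass k Y c"
proof -
  have "hclass k Y x = hclass k Y c" if "x \<in> hclass k X c" for x
    unfolding hclass_eq_iff[OF assms(1)]
    using that[unfolded hclass_iff] by (rule subsetD[OF rel_boundaries_mono[OF assms(2,3)]])
  then have "incl_map k Y (hclass k X c) = (\<Union>x\<in>hclass k X c. hclass k Y c)"
    unfolding incl_map_def hclass_eq_coset by (intro SUP_cong refl)
  also have "\<dots> = hclass k Y c" using hclass_self[of c k X] by auto
  finally show ?thesis .
qed

lemma incl_map_linear:
  assumes "closed_pair K X" "closed_pair K Y" "fst X \<subseteq> fst Y" "snd X \<subseteq> snd Y"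
  shows "linear_map class_ring (homology k X) (homology k Y)
           (incl_map k Y :: ('v set \<Rightarrow> 'f::field) set \<Rightarrow> _)"
proof (rule linear_mapI)
  have incl: "incl_map k Y (hclass k X c) = hclass k Y c" for c :: "'v set \<Rightarrow> 'f"
    by (rule incl_map_hclass[OF assms(2-4)])
  have in_Y: "hclass k Y c \<in> carrier (homology k Y)"
    if "c \<in> carrier (rel_cycles k (fst X) (snd X))" for c :: "'v set \<Rightarrow> 'f"
    using subsetD[OF rel_cycles_mono[OF assms(3,4)] that] by (simp add: homology_simps(1))
  note simps = homology_simps(1) incl in_Y hclass_add[OF assms(1)] hclass_add[OF assms(2)]
    hclass_scale[OF assms(1)] hclass_scale[OF assms(2)]
  fix U W :: "('v set \<Rightarrow> 'f) set" and a
  assume U: "U \<in> carrier (homology k X)"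
  then obtain c where c: "c \<in> carrier (rel_cycles k (fst X) (snd X))" "U = hclass k X c"
    unfolding homology_simps(1) by (rule imageE) metis
  show "incl_map k Y U \<in> carrier (homology k Y)" unfolding c(2) incl by (rule in_Y[OF c(1)])
  show "incl_map k Y (a \<odot>\<^bsub>homology k X\<^esub> U) = a \<odot>\<^bsub>homology k Y\<^esub> incl_map k Y U"
    unfolding c(2) by (simp only: simps)
  assume "W \<in> carrier (homology k X)"
  then obtain d where d: "W = hclass k X d"
    unfolding homology_simps(1) by (rule imageE) metis
  show "incl_map k Y (U \<oplus>\<^bsub>homology k X\<^esub> W) = incl_map k Y U \<oplus>\<^bsub>homology k Y\<^esub> incl_map k Y W"
    unfolding c(2) d by (simp only: simps)
qed (intro homology_vectorspace assms(1,2))+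

end

section \<open>Acyclic pairs\<close>

text \<open>Vanishing of H(A, B) in all degrees, stated for chains so that a filling can be taken
  directly from it.\<close>

definition acyclic_pair :: "'f::field itself \<Rightarrow> 'v::linorder set set \<Rightarrow> 'v set set \<Rightarrow> bool" where
  "acyclic_pair F A B \<longleftrightarrow>
     (\<forall>k. carrier (rel_cycles k A B :: ('f, 'v set \<Rightarrow> 'f) module) \<subseteq> rel_boundaries k A B)"

lemma acyclic_pairD:
  fixes c :: "'v::linorder set \<Rightarrow> 'f::field"
  assumes "acyclic_pair TYPE('f) A B" "c \<in> chains k A" "bd c \<in> chains (k - 1) B"
  obtains d b where "d \<in> chains (Suc k) A" "b \<in> chains k B" "c = bd d + b"
proof -
  have "c \<in> rel_boundaries k A B"
    using assms(2,3) subsetD[OF spec[OF assms(1)[unfolded acyclic_pair_def]]]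
    by (simp add: rel_cycles_simps)
  then show thesis using that by (rule rel_boundariesE)
qed

context complex_on
begin

lemma acyclic_pair_refl:
  fixes A :: "'v set set"
  shows "acyclic_pair TYPE('f::field) A A"
  unfolding acyclic_pair_def
proof (intro allI subsetI)
  fix k and c :: "'v set \<Rightarrow> 'f" assume "c \<in> carrier (rel_cycles k A A)"
  then show "c \<in> rel_boundaries k A A"
    by (intro rel_boundariesI[of 0 _ _ c]) (simp_all add: rel_cycles_simps)
qed

text \<open>Exactness for the triple B, C, A: filling c modulo C leaves a remainder x in C with the
  same boundary as c, so x is a cycle relative to B and can be filled in C.\<close>

lemma acyclic_pair_trans:
  assumes "acyclic_pair TYPE('f::field) A C" "acyclic_pair TYPE('f) C B"
    and closed: "closed_in_complex K A" "C \<subseteq> A" "B \<subseteq> C"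
  shows "acyclic_pair TYPE('f) A B"
  unfolding acyclic_pair_def
proof (intro allI subsetI)
  fix k and c :: "'v set \<Rightarrow> 'f" assume "c \<in> carrier (rel_cycles k A B)"
  then have c: "c \<in> chains k A" "bd c \<in> chains (k - 1) B" by (simp_all add: rel_cycles_simps)
  note fin = closed_finite[OF closed(1)]
  have "bd c \<in> chains (k - 1) C" using c(2) closed(3) by (rule chains_monoD)
  then obtain d x where
    d: "d \<in> chains (Suc k) A" "x \<in> chains k C" "c = bd d + x"
    by (rule acyclic_pairD[OF assms(1) c(1)])
  have x: "x \<in> chains k A" using d(2) closed(2) by (rule chains_monoD)
  have "bd x = bd c - bd (bd d)"
    using d(3) bd_diff[OF fin c(1) x] bd_diff[OF fin c(1) chains_diff[OF c(1) x]] by simp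
  also have "bd (bd d) = 0" using bd_bd[OF closed_in_complex_subset[OF closed(1)] d(1)] .
  finally have "bd x \<in> chains (k - 1) B" using c(2) by simp
  then obtain e b where
    e: "e \<in> chains (Suc k) C" "b \<in> chains k B" "x = bd e + b"
    by (rule acyclic_pairD[OF assms(2) d(2)])
  have e': "e \<in> chains (Suc k) A" using e(1) closed(2) by (rule chains_monoD)
  have "c = bd (d + e) + b" using d(3) e(3) bd_add[OF fin d(1) e'] by simp
  with chains_add[OF d(1) e'] e(2) show "c \<in> rel_boundaries k A B" by (rule rel_boundariesI)
qed

text \<open>Only the part of c on A has to be filled: its boundary lies in A and, being the
  difference of the boundaries of c and of the rest, in B, hence in C. When A is the closure of a
  multivector, C will be its mouth.\<close>

lemma acyclic_pair_excision:
  assumes "acyclic_pair TYPE('f::field) A C"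
    and closed: "closed_in_complex K A" "closed_in_complex K B"
    and C: "A \<inter> B \<subseteq> C" "C \<subseteq> B"
  shows "acyclic_pair TYPE('f) (A \<union> B) B"
  unfolding acyclic_pair_def
proof (intro allI subsetI)
  fix k and c :: "'v set \<Rightarrow> 'f" assume "c \<in> carrier (rel_cycles k (A \<union> B) B)"
  then have c: "c \<in> chains k (A \<union> B)" "bd c \<in> chains (k - 1) B" by (simp_all add: rel_cycles_simps)
  have U: "finite (A \<union> B)" using closed closed_finite by simp
  from c(1) obtain a b where ab: "a \<in> chains k A" "b \<in> chains k B" "c = a + b"
    by (rule chains_Un_split)
  have b: "b \<in> chains k (A \<union> B)" using ab(2) by (rule chains_monoD) simp
  have "bd a = bd c - bd b"
    using bd_diff[OF U c(1) b] ab(3) by simp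
  then have "bd a \<in> chains (k - 1) B"
    using chains_diff[OF c(2) bd_in_chains[OF closed(2) ab(2)]] by simp
  then have "bd a \<in> chains (k - 1) C"
    using chains_monoD[OF chains_Int[OF bd_in_chains[OF closed(1) ab(1)]] C(1)] by simp
  then obtain d e where
    d: "d \<in> chains (Suc k) A" "e \<in> chains k C" "a = bd d + e"
    by (rule acyclic_pairD[OF assms(1) ab(1)])
  have "c = bd d + (e + b)" using d(3) ab(3) by (simp add: add_ac)
  moreover have "d \<in> chains (Suc k) (A \<union> B)" using d(1) by (rule chains_monoD) simp
  moreover have "e + b \<in> chains k B" using chains_add[OF chains_monoD[OF d(2) C(2)] ab(2)] .
  ultimately show "c \<in> rel_boundaries k (A \<union> B) B" by (intro rel_boundariesI)
qed

text \<open>The first acyclicity moves c into A \<union> B' by a boundary, and the part b in B' may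
  be dropped. The rest a has its boundary in A \<inter> B'; the second acyclicity, one degree lower,
  yields a correction e in A \<inter> B' that brings the boundary into B.\<close>

lemma incl_map_surj:
  fixes A B :: "'v set set"
  assumes XY: "closed_pair K (A, B)" "closed_pair K (A', B')" "A \<subseteq> A'" "B \<subseteq> B'"
    and acyc: "acyclic_pair TYPE('f::field) A' (A \<union> B')" "acyclic_pair TYPE('f) (A \<inter> B') B"
    and c: "c \<in> carrier (rel_cycles k A' B' :: ('f, _) module)"
  shows "\<exists>a \<in> carrier (rel_cycles k A B). c - a \<in> rel_boundaries k A' B'"
proof -
  have closed: "closed_in_complex K A" "closed_in_complex K A'" "closed_in_complex K B'" "B' \<subseteq> A'"
    using XY by (auto simp: closed_pair_def)
  note fin = closed_finite[OF closed(2)]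
  have c: "c \<in> chains k A'" "bd c \<in> chains (k - 1) B'" using c by (simp_all add: rel_cycles_simps)
  have "bd c \<in> chains (k - 1) (A \<union> B')" using c(2) by (rule chains_monoD) simp
  then obtain d x where
    d: "d \<in> chains (Suc k) A'" "x \<in> chains k (A \<union> B')" "c = bd d + x"
    by (rule acyclic_pairD[OF acyc(1) c(1)])
  from d(2) obtain a b where ab: "a \<in> chains k A" "b \<in> chains k B'" "x = a + b"
    by (rule chains_Un_split)
  note ab' = chains_monoD[OF ab(1) XY(3)] chains_monoD[OF ab(2) closed(4)]
  have bdd: "bd d \<in> chains k A'" "bd (bd d) = 0"
    using bd_in_chains[OF closed(2) d(1)] bd_bd[OF closed_in_complex_subset[OF closed(2)] d(1)]
    by simp_all
  have "a = c - bd d - b" using d(3) ab(3) by simp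
  then have bda: "bd a = bd c - bd b"
    using bd_diff[OF fin c(1) bdd(1)] bd_diff[OF fin chains_diff[OF c(1) bdd(1)] ab'(2)] bdd(2)
    by simp
  have bda_in: "bd a \<in> chains (k - 1) (A \<inter> B')"
  proof (rule chains_Int)
    show "bd a \<in> chains (k - 1) B'"
      unfolding bda using chains_diff[OF c(2) bd_in_chains[OF closed(3) ab(2)]] .
  qed (rule bd_in_chains[OF closed(1) ab(1)])
  \<comment> \<open>In degree 0 there is no lower degree to use, but then \<open>bd a\<close>
    vanishes and e = f = 0 will do.\<close>
  have "\<exists>e f. e \<in> chains k (A \<inter> B') \<and> f \<in> chains (k - 1) B \<and> bd a = bd e + f"
  proof (cases k)
    case 0
    then have "bd a = 0" using bd_chains_0 closed_in_complex_subset[OF closed(1)] ab(1) by simp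
    then show ?thesis by (intro exI[of _ 0]) simp_all
  next
    case (Suc l)
    have "bd (bd a) = 0" using bd_bd[OF closed_in_complex_subset[OF closed(1)] ab(1)] .
    then have "bd (bd a) \<in> chains (k - 1 - 1) B" by simp
    then obtain e f where "e \<in> chains (Suc (k - 1)) (A \<inter> B')" "f \<in> chains (k - 1) B" "bd a = bd e + f"
      by (rule acyclic_pairD[OF acyc(2) bda_in])
    then show ?thesis unfolding Suc by (intro exI conjI) simp_all
  qed
  then obtain e f where e: "e \<in> chains k (A \<inter> B')" "f \<in> chains (k - 1) B" "bd a = bd e + f"
    by (elim exE conjE)
  have e': "e \<in> chains k A" "e \<in> chains k B'" using e(1) by (auto intro: chains_monoD)
  have "bd (a - e) = f"
    using bd_diff[OF closed_finite[OF closed(1)] ab(1) e'(1)] e(3) by simp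
  then have "a - e \<in> carrier (rel_cycles k A B)"
    using e(2) chains_diff[OF ab(1) e'(1)] by (simp add: rel_cycles_simps)
  moreover have "c - (a - e) = bd d + (b + e)" using d(3) ab(3) by simp
  with d(1) chains_add[OF ab(2) e'(2)] have "c - (a - e) \<in> rel_boundaries k A' B'"
    by (rule rel_boundariesI)
  ultimately show ?thesis by (intro bexI[of _ "a - e"])
qed

text \<open>If c = bd d + b with d in A', the first acyclicity replaces d by a chain y in A \<union>
  B' with the same boundary. Subtracting from c the boundary of the part y1 in A leaves a chain in A
  \<inter> B' with boundary in B, and the second acyclicity fills it.\<close>

lemma incl_map_inj:
  fixes A B :: "'v set set" and c :: "'v set \<Rightarrow> 'f::field"
  assumes XY: "closed_pair K (A, B)" "closed_pair K (A', B')" "A \<subseteq> A'" "B \<subseteq> B'"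
    and acyc: "acyclic_pair TYPE('f::field) A' (A \<union> B')" "acyclic_pair TYPE('f) (A \<inter> B') B"
    and c: "c \<in> carrier (rel_cycles k A B)" "c \<in> rel_boundaries k A' B'"
  shows "c \<in> rel_boundaries k A B"
proof -
  have closed: "closed_in_complex K A" "closed_in_complex K A'" "closed_in_complex K B'" "B' \<subseteq> A'"
    using XY by (auto simp: closed_pair_def)
  note fin = closed_finite[OF closed(2)]
  have c': "c \<in> chains k A" "bd c \<in> chains (k - 1) B" using c(1) by (simp_all add: rel_cycles_simps)
  from c(2) obtain d b where d: "d \<in> chains (Suc k) A'" "b \<in> chains k B'" "c = bd d + b"
    by (rule rel_boundariesE)
  have "c - b \<in> chains k (A \<union> B')"
    by (intro chains_diff chains_monoD[OF c'(1)] chains_monoD[OF d(2)]) auto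
  moreover have "bd d = c - b" using d(3) by simp
  ultimately have "bd d \<in> chains (Suc k - 1) (A \<union> B')" by simp
  then obtain x y where
    x: "x \<in> chains (Suc (Suc k)) A'" "y \<in> chains (Suc k) (A \<union> B')" "d = bd x + y"
    by (rule acyclic_pairD[OF acyc(1) d(1)])
  from x(2) obtain y1 y2 where y: "y1 \<in> chains (Suc k) A" "y2 \<in> chains (Suc k) B'" "y = y1 + y2"
    by (rule chains_Un_split)
  note y' = chains_monoD[OF y(1) XY(3)] chains_monoD[OF y(2) closed(4)]
  have bdx: "bd x \<in> chains (Suc k) A'" "bd (bd x) = 0"
    using bd_in_chains[OF closed(2) x(1)] bd_bd[OF closed_in_complex_subset[OF closed(2)] x(1)]
    by simp_all
  have bdd: "bd d = bd y1 + bd y2"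
    using bd_add[OF fin bdx(1) chains_add[OF y']] bd_add[OF fin y'] bdx(2) x(3) y(3) by simp
  have bdy: "bd y1 \<in> chains k A" "bd y2 \<in> chains k B'"
    using bd_in_chains[OF closed(1) y(1)] bd_in_chains[OF closed(3) y(2)] by simp_all
  have "c - bd y1 = bd y2 + b" using d(3) bdd by simp
  then have "c - bd y1 \<in> chains k (A \<inter> B')"
    using chains_Int[OF chains_diff[OF c'(1) bdy(1)], of B'] chains_add[OF bdy(2) d(2)] by simp
  moreover have "bd (c - bd y1) = bd c"
    using bd_diff[OF closed_finite[OF closed(1)] c'(1) bdy(1)]
      bd_bd[OF closed_in_complex_subset[OF closed(1)] y(1)] by simp
  then have "bd (c - bd y1) \<in> chains (k - 1) B" using c'(2) by simp
  ultimately obtain u v where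
    u: "u \<in> chains (Suc k) (A \<inter> B')" "v \<in> chains k B" "c - bd y1 = bd u + v"
    by (rule acyclic_pairD[OF acyc(2)])
  have u': "u \<in> chains (Suc k) A" using u(1) by (rule chains_monoD) simp
  have "c = bd (y1 + u) + v"
    using u(3) bd_add[OF closed_finite[OF closed(1)] y(1) u'] by (simp add: algebra_simps)
  with chains_add[OF y(1) u'] u(2) show ?thesis by (rule rel_boundariesI)
qed

text \<open>The inclusion factors through (A, A \<inter> B') and (A \<union> B', B'). The middle map
  is an excision, and the obstructions to the outer two are the homology of (A \<inter> B', B) and
  of (A', A \<union> B').\<close>

lemma incl_map_bij:
  fixes A B :: "'v set set"
  assumes XY: "closed_pair K (A, B)" "closed_pair K (A', B')" "A \<subseteq> A'" "B \<subseteq> B'"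
    and acyc: "acyclic_pair TYPE('f::field) A' (A \<union> B')" "acyclic_pair TYPE('f) (A \<inter> B') B"
  shows "bij_betw (incl_map k (A', B')) (carrier (homology k (A, B)))
           (carrier (homology k (A', B') :: ('f, ('v set \<Rightarrow> 'f) set) module))"
  unfolding bij_betw_def
proof
  have incl: "incl_map k (A', B') (hclass k (A, B) c) = hclass k (A', B') c" for c :: "'v set \<Rightarrow> 'f"
    using incl_map_hclass[OF XY(2), of "(A, B)"] XY(3,4) by simp
  have closed: "closed_in_complex K A" using XY(1) by (simp add: closed_pair_def)
  show "inj_on (incl_map k (A', B')) (carrier (homology k (A, B) :: ('f, ('v set \<Rightarrow> 'f) set) module))"
  proof (rule inj_onI, unfold homology_simps(1), elim imageE, simp add: incl)
    fix c d :: "'v set \<Rightarrow> 'f"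
    assume cd: "c \<in> carrier (rel_cycles k A B)" "d \<in> carrier (rel_cycles k A B)"
    have "c + scale (-1) d \<in> carrier (rel_cycles k A B)"
      by (intro rel_cycles_add rel_cycles_scale closed cd)
    moreover have "c + scale (-1) d = c - d" by (auto simp: scale_def fun_eq_iff)
    moreover assume "hclass k (A', B') c = hclass k (A', B') d"
    ultimately show "hclass k (A, B) c = hclass k (A, B) d"
      using incl_map_inj[OF XY acyc, of "c - d" k]
      by (simp add: hclass_eq_iff[OF XY(1)] hclass_eq_iff[OF XY(2)])
  qed
  show "incl_map k (A', B') ` carrier (homology k (A, B)) =
      carrier (homology k (A', B') :: ('f, ('v set \<Rightarrow> 'f) set) module)"
  proof
    show "incl_map k (A', B') ` carrier (homology k (A, B)) \<subseteq>
        carrier (homology k (A', B') :: ('f, ('v set \<Rightarrow> 'f) set) module)"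
      unfolding homology_simps(1) fst_conv snd_conv image_image incl
      by (intro image_mono rel_cycles_mono XY(3,4))
  next
    show "carrier (homology k (A', B') :: ('f, ('v set \<Rightarrow> 'f) set) module) \<subseteq>
        incl_map k (A', B') ` carrier (homology k (A, B))"
    proof
      fix U assume "U \<in> carrier (homology k (A', B') :: ('f, ('v set \<Rightarrow> 'f) set) module)"
      then obtain c where c: "c \<in> carrier (rel_cycles k A' B')" "U = hclass k (A', B') c"
        by (auto simp: homology_simps(1))
      obtain a where "a \<in> carrier (rel_cycles k A B)" "c - a \<in> rel_boundaries k A' B'"
        using incl_map_surj[OF XY acyc c(1)] by blast
      then have "U = incl_map k (A', B') (hclass k (A, B) a)"
        "hclass k (A, B) a \<in> carrier (homology k (A, B))"
        using c(2) by (auto simp: incl hclass_eq_iff[OF XY(2)] homology_simps(1))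
      then show "U \<in> incl_map k (A', B') ` carrier (homology k (A, B))" by blast
    qed
  qed
qed

end

section \<open>Essential solutions in saturated sets\<close>

lemma flow_singleton: "\<tau> \<in> flow K V {\<sigma>} \<longleftrightarrow> \<tau> \<in> K \<and> \<tau> \<subseteq> \<sigma> \<or> \<tau> \<in> mv_of V \<sigma>"
  by (simp add: flow_def cl_def)

lemma flow_iff: "\<tau> \<in> flow K V A \<longleftrightarrow> (\<exists>\<sigma>\<in>A. \<tau> \<in> flow K V {\<sigma>})"
  by (auto simp: flow_def)

lemma Inv_subset: "Inv F K V A \<subseteq> A"
  by (auto simp: Inv_def)

lemma Inv_mono: "A \<subseteq> B \<Longrightarrow> Inv F K V A \<subseteq> Inv F K V B"
  unfolding Inv_def by blast

text \<open>Closes a sequence of choices in a finite set to a cycle, along which a solution can run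
  over all integers.\<close>

lemma periodic_point:
  assumes "finite T" "T \<noteq> {}" "f \<in> T \<rightarrow> T"
  obtains x q where "x \<in> T" "q > 0" "(f ^^ q) x = x"
proof -
  obtain y where y: "y \<in> T" using assms(2) by blast
  have in_T: "(f ^^ n) y \<in> T" for n
    using assms(3) y by (induction n) auto
  have "\<not> inj (\<lambda>n. (f ^^ n) y)"
    using finite_subset[OF _ assms(1)] in_T finite_imageD[of "\<lambda>n. (f ^^ n) y" UNIV]
    by (metis image_subset_iff infinite_UNIV_nat)
  then obtain i j where "i < j" "(f ^^ i) y = (f ^^ j) y"
    unfolding inj_def by (metis linorder_neqE_nat)
  then have "(f ^^ (j - i)) ((f ^^ i) y) = (f ^^ i) y"
    by (metis add_diff_cancel_right' comp_apply funpow_add le_add_diff_inverse2 less_imp_le_nat)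
  then show thesis using that[of "(f ^^ i) y" "j - i"] in_T \<open>i < j\<close> by simp
qed

locale mvf = complex_on K for K :: "'v::linorder set set" +
  fixes V :: "'v set set set"
  assumes field: "multivector_field K V"
begin

lemma mv_of_eq: "W \<in> V \<Longrightarrow> \<sigma> \<in> W \<Longrightarrow> mv_of V \<sigma> = W"
  using field unfolding mv_of_def multivector_field_def partition_on_def disjoint_def
  by (intro the_equality) blast+

lemma mv_of_in: "\<sigma> \<in> K \<Longrightarrow> mv_of V \<sigma> \<in> V" and self_in_mv_of: "\<sigma> \<in> K \<Longrightarrow> \<sigma> \<in> mv_of V \<sigma>"
proof -
  assume "\<sigma> \<in> K"
  then obtain W where "W \<in> V" "\<sigma> \<in> W"
    using field unfolding multivector_field_def partition_on_def by blast
  with mv_of_eq[OF this] show "mv_of V \<sigma> \<in> V" "\<sigma> \<in> mv_of V \<sigma>" by simp_all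
qed

lemma multivector_mv_of: "\<sigma> \<in> K \<Longrightarrow> multivector K (mv_of V \<sigma>)"
  using field mv_of_in unfolding multivector_field_def by blast

lemma mv_of_subset: "\<sigma> \<in> K \<Longrightarrow> mv_of V \<sigma> \<subseteq> K"
  using multivector_mv_of unfolding multivector_def by blast

lemma mv_of_mem: "\<sigma> \<in> K \<Longrightarrow> \<tau> \<in> mv_of V \<sigma> \<Longrightarrow> mv_of V \<tau> = mv_of V \<sigma>"
  using mv_of_eq mv_of_in by blast

lemma self_in_flow: "\<sigma> \<in> K \<Longrightarrow> \<sigma> \<in> flow K V {\<sigma>}"
  by (simp add: flow_singleton)

text \<open>A constant solution is essential in a critical multivector. Subsets of K with empty
  invariant part therefore meet only noncritical multivectors.\<close>

lemma critical_in_Inv: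
  assumes "\<sigma> \<in> A" "A \<subseteq> K" "critical F K (mv_of V \<sigma>)"
  shows "\<sigma> \<in> Inv F K V A"
proof -
  have "is_essential_solution F K V (\<lambda>_. \<sigma>)"
    using assms self_in_flow unfolding is_essential_solution_def is_solution_def by auto
  then show ?thesis unfolding Inv_def using assms(1) by auto
qed

text \<open>Otherwise every \<sigma> in T has a point \<open>s \<sigma>\<close> in its multivector
  with a face \<open>f \<sigma>\<close> in T outside that multivector. On a periodic orbit of f the
  steps from \<sigma> to \<open>s \<sigma>\<close> to \<open>f \<sigma>\<close> form a solution in T
  that keeps changing its multivector, hence an essential one.\<close>

lemma mo_mv_of_disjoint:
  assumes T: "T \<subseteq> K" "T \<noteq> {}" and sat: "\<And>\<sigma>. \<sigma> \<in> T \<Longrightarrow> mv_of V \<sigma> \<subseteq> T"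
    and Inv: "Inv F K V T = {}"
  shows "\<exists>\<sigma>\<in>T. mo K (mv_of V \<sigma>) \<inter> T = {}"
proof (rule ccontr)
  assume "\<not> ?thesis"
  then have "\<forall>\<sigma>\<in>T. \<exists>\<tau> \<rho>. \<tau> \<in> T \<and> \<tau> \<notin> mv_of V \<sigma> \<and> \<rho> \<in> mv_of V \<sigma> \<and> \<tau> \<subseteq> \<rho>"
    unfolding mo_def cl_def by blast
  then obtain f s where fs: "\<And>\<sigma>. \<sigma> \<in> T \<Longrightarrow> f \<sigma> \<in> T" "\<And>\<sigma>. \<sigma> \<in> T \<Longrightarrow> f \<sigma> \<notin> mv_of V \<sigma>"
    "\<And>\<sigma>. \<sigma> \<in> T \<Longrightarrow> s \<sigma> \<in> mv_of V \<sigma>" "\<And>\<sigma>. \<sigma> \<in> T \<Longrightarrow> f \<sigma> \<subseteq> s \<sigma>"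
    by metis
  obtain x q where x: "x \<in> T" "q > 0" "(f ^^ q) x = x"
    using periodic_point[of T f] finite_subset[OF T(1) finite_K] T(2) fs(1) by blast
  have fT: "(f ^^ n) x \<in> T" for n
    using fs(1) x(1) by (induction n) auto
  \<comment> \<open>The periodic orbit of f, continued to negative times by reducing modulo the
    period.\<close>
  define t :: "int \<Rightarrow> 'v set" where "t j = (f ^^ nat (j mod int q)) x" for j
  have tT: "t j \<in> T" for j unfolding t_def by (rule fT)
  have t_Suc: "t (j + 1) = f (t j)" for j
  proof (cases "j mod int q + 1 = int q")
    case True
    then have "(j + 1) mod int q = 0" by (metis mod_add_left_eq mod_self)
    moreover from True have "q = Suc (nat (j mod int q))" using x(2) by simp
    ultimately show ?thesis using x(3) unfolding t_def
      by (metis funpow.simps(2) comp_apply funpow_0 nat_zero_as_int of_nat_0)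
  next
    case False
    have bounds: "0 \<le> j mod int q" "j mod int q < int q" using x(2) by auto
    then have "(j mod int q + 1) mod int q = j mod int q + 1" using False
      by (intro mod_pos_pos_trivial) auto
    then have "(j + 1) mod int q = j mod int q + 1" by (simp add: mod_add_left_eq)
    then have "nat ((j + 1) mod int q) = Suc (nat (j mod int q))" using bounds by simp
    then show ?thesis unfolding t_def by simp
  qed
  \<comment> \<open>Even times carry the points of the orbit, odd times the intermediate points that
    have the next orbit point as a face.\<close>
  define \<rho> where "\<rho> z = (if even z then t (z div 2) else s (t (z div 2)))" for z :: int
  have \<rho>T: "\<rho> z \<in> T" for z
    using tT fs(3) sat unfolding \<rho>_def by auto
  have mv\<rho>: "mv_of V (\<rho> z) = mv_of V (t (z div 2))" for z
    using mv_of_mem[of "t (z div 2)" "s (t (z div 2))"] fs(3)[OF tT] tT T(1) unfolding \<rho>_def by auto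
  have mv_ne: "mv_of V (t (j + 1)) \<noteq> mv_of V (t j)" for j
    unfolding t_Suc using fs(2)[OF tT] self_in_mv_of fs(1)[OF tT] T(1) by blast
  have "\<rho> (z + 1) \<in> flow K V {\<rho> z}" for z
  proof (cases "even z")
    case True
    then have "(z + 1) div 2 = z div 2" by (auto elim!: evenE)
    then show ?thesis using True fs(3)[OF tT] unfolding \<rho>_def flow_singleton by simp
  next
    case False
    then have "(z + 1) div 2 = z div 2 + 1" by (auto elim!: oddE)
    then show ?thesis using False fs(4)[OF tT] fs(1)[OF tT] T(1)
      unfolding \<rho>_def flow_singleton by (auto simp: t_Suc)
  qed
  \<comment> \<open>Two steps in either direction change \<open>z div 2\<close> by one and so change
    the multivector.\<close>
  moreover have "mv_of V (\<rho> (z - 2)) \<noteq> mv_of V (\<rho> z)" "mv_of V (\<rho> z) \<noteq> mv_of V (\<rho> (z + 2))" for z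
  proof -
    have "z div 2 = (z - 2) div 2 + 1" "(z + 2) div 2 = z div 2 + 1" by auto
    then show "mv_of V (\<rho> (z - 2)) \<noteq> mv_of V (\<rho> z)" "mv_of V (\<rho> z) \<noteq> mv_of V (\<rho> (z + 2))"
      unfolding mv\<rho> using mv_ne by metis+
  qed
  moreover have "\<rho> z \<in> K" for z using \<rho>T T(1) by blast
  ultimately have "is_essential_solution F K V \<rho>"
    unfolding is_essential_solution_def is_solution_def
    by (metis diff_add_cancel less_add_same_cancel1 zero_less_numeral)
  then have "\<rho> 0 \<in> Inv F K V T"
    unfolding Inv_def using \<rho>T by auto
  then show False using Inv by simp
qed

text \<open>Convexity enters here: if a face \<tau> of \<sigma> in the mouth lay in W, then \<sigma>
  would lie between two elements of W and so in W itself.\<close>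

lemma closed_mo:
  assumes "multivector K W"
  shows "closed_in_complex K (mo K W)"
proof (rule closed_in_complexI)
  show "mo K W \<subseteq> K" by (auto simp: mo_def cl_def)
  fix \<sigma> \<tau> assume *: "\<sigma> \<in> mo K W" "\<tau> \<in> K" "\<tau> \<subseteq> \<sigma>"
  then obtain \<omega> where \<omega>: "\<sigma> \<in> K" "\<sigma> \<notin> W" "\<omega> \<in> W" "\<sigma> \<subseteq> \<omega>"
    unfolding mo_def cl_def by auto
  have "\<tau> \<notin> W"
    using \<omega> *(3) assms unfolding multivector_def by (metis (no_types, lifting))
  moreover have "\<tau> \<subseteq> \<omega>" using * \<omega> by (metis subset_trans)
  ultimately show "\<tau> \<in> mo K W" using * \<omega> unfolding mo_def cl_def by auto
qed

lemma acyclic_pair_noncritical: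
  assumes "multivector K W" "\<not> critical TYPE('f::field) K W"
  shows "acyclic_pair TYPE('f) (cl K W) (mo K W)"
  unfolding acyclic_pair_def
proof (intro allI subsetI)
  fix k and c :: "'v set \<Rightarrow> 'f" assume c: "c \<in> carrier (rel_cycles k (cl K W) (mo K W))"
  have X: "closed_pair K (cl K W, mo K W)"
    using closed_mo[OF assms(1)] closed_in_complex_cl by (auto simp: closed_pair_def mo_def)
  have "hclass k (cl K W, mo K W) c = hclass k (cl K W, mo K W) 0"
    using assms(2) c unfolding critical_def Let_def homology_zero by (auto simp: homology_simps(1))
  then show "c \<in> rel_boundaries k (cl K W) (mo K W)"
    by (simp add: hclass_eq_iff[OF X])
qed

text \<open>A saturated set without essential solutions is removed one multivector at a time: as the
  flow has no cycles through different multivectors, some multivector of the set has its mouth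
  outside of it.\<close>

lemma acyclic_pair_if_Inv_empty:
  assumes "closed_in_complex K A" "closed_in_complex K B" "B \<subseteq> A"
    and "\<And>\<sigma>. \<sigma> \<in> A - B \<Longrightarrow> mv_of V \<sigma> \<subseteq> A - B"
    and "Inv TYPE('f::field) K V (A - B) = {}"
  shows "acyclic_pair TYPE('f) A B"
  using assms(2-)
proof (induction "card (A - B)" arbitrary: B rule: less_induct)
  case less
  show ?case
  proof (cases "A - B = {}")
    case True
    then show ?thesis using less.prems(2) acyclic_pair_refl[of A] by (metis Diff_eq_empty_iff subset_antisym)
  next
    case False
    have TK: "A - B \<subseteq> K" using closed_in_complex_subset[OF assms(1)] by blast
    obtain \<sigma> where \<sigma>: "\<sigma> \<in> A - B" "mo K (mv_of V \<sigma>) \<inter> (A - B) = {}"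
      using mo_mv_of_disjoint[OF TK False less.prems(3,4)] by blast
    define W where "W = mv_of V \<sigma>"
    have \<sigma>K: "\<sigma> \<in> K" using \<sigma>(1) TK by blast
    have W: "multivector K W" "W \<subseteq> A - B" "\<sigma> \<in> W" "W \<subseteq> K"
      using multivector_mv_of[OF \<sigma>K] less.prems(3)[OF \<sigma>(1)] self_in_mv_of[OF \<sigma>K] mv_of_subset[OF \<sigma>K]
      unfolding W_def by auto
    have clA: "cl K W \<subseteq> A"
      using W(2) closed_in_complex_face[OF assms(1)] unfolding cl_def by blast
    then have mo: "mo K W \<subseteq> B" using \<sigma>(2) unfolding W_def[symmetric] mo_def by blast
    have W_cl: "W \<subseteq> cl K W" using W(4) unfolding cl_def by blast
    have "\<not> critical TYPE('f) K W"
      using critical_in_Inv[OF \<sigma>(1) TK] less.prems(4) unfolding W_def by blast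
    then have "acyclic_pair TYPE('f) (cl K W) (mo K W)"
      by (rule acyclic_pair_noncritical[OF W(1)])
    \<comment> \<open>The closure of W meets B exactly in the mouth, so adding W to B does not
      change the homology. What remains of A - B after the removal of W is again saturated.\<close>
    then have 1: "acyclic_pair TYPE('f) (cl K W \<union> B) B"
      using closed_in_complex_cl less.prems(1) _ mo
    proof (rule acyclic_pair_excision)
      show "cl K W \<inter> B \<subseteq> mo K W" using W(2) unfolding mo_def by blast
    qed
    have diff: "A - (cl K W \<union> B) = (A - B) - W"
      using mo W_cl unfolding mo_def by blast
    have "mv_of V \<tau> \<subseteq> (A - B) - W" if \<tau>: "\<tau> \<in> (A - B) - W" for \<tau>
    proof -
      have "mv_of V \<tau> \<inter> W = {}"
        using mv_of_eq[OF mv_of_in[OF \<sigma>K], of _] mv_of_mem[of \<tau>] self_in_mv_of \<tau> TK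
        unfolding W_def by blast
      then show ?thesis using less.prems(3)[of \<tau>] \<tau> by blast
    qed
    moreover have "Inv TYPE('f) K V (A - (cl K W \<union> B)) = {}"
      using Inv_mono[of "A - (cl K W \<union> B)" "A - B"] less.prems(4) by blast
    moreover have "card (A - (cl K W \<union> B)) < card (A - B)"
      unfolding diff using W(3) \<sigma>(1) finite_subset[OF TK finite_K] by (intro psubset_card_mono) auto
    ultimately have 2: "acyclic_pair TYPE('f) A (cl K W \<union> B)"
      using closed_in_complex_Un[OF closed_in_complex_cl less.prems(1)] clA less.prems(2)
      by (intro less.hyps) (auto simp: diff)
    show ?thesis
      by (rule acyclic_pair_trans[OF 2 1 assms(1)]) (use clA less.prems(2) in auto)
  qed
qed

section \<open>Rays and invariant sets\<close>

text \<open>Half of an essential solution. The relation r fixes the direction of time, so both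
  halves share one definition; a backward ray is indexed by the distance into the past.\<close>

definition ess_ray :: "'f::field itself \<Rightarrow> ('v set \<Rightarrow> 'v set \<Rightarrow> bool) \<Rightarrow> 'v set set \<Rightarrow> 'v set \<Rightarrow> bool" where
  "ess_ray F r A x \<longleftrightarrow>
     (\<exists>\<rho>. \<rho> 0 = x \<and> (\<forall>i. \<rho> i \<in> A \<and> r (\<rho> i) (\<rho> (Suc i)) \<and>
        (\<not> critical F K (mv_of V (\<rho> i)) \<longrightarrow> (\<exists>j>i. mv_of V (\<rho> j) \<noteq> mv_of V (\<rho> i)))))"

abbreviation "forward_ray F \<equiv> ess_ray F (\<lambda>x y. y \<in> flow K V {x})"
abbreviation "backward_ray F \<equiv> ess_ray F (\<lambda>x y. x \<in> flow K V {y})"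

text \<open>If x is in another multivector than y, the step itself is the required change. If not,
  the change that the ray provides for y serves x as well.\<close>

lemma ess_ray_Cons:
  assumes "ess_ray F r A y" "r x y" "x \<in> A"
  shows "ess_ray F r A x"
proof -
  from assms(1) obtain \<rho> where \<rho>: "\<rho> 0 = y" "\<And>i. \<rho> i \<in> A" "\<And>i. r (\<rho> i) (\<rho> (Suc i))"
    "\<And>i. \<not> critical F K (mv_of V (\<rho> i)) \<Longrightarrow> \<exists>j>i. mv_of V (\<rho> j) \<noteq> mv_of V (\<rho> i)"
    unfolding ess_ray_def by blast
  define \<rho>' where "\<rho>' = case_nat x \<rho>"
  have "\<exists>j>i. mv_of V (\<rho>' j) \<noteq> mv_of V (\<rho>' i)" if crit: "\<not> critical F K (mv_of V (\<rho>' i))" for i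
  proof (cases i)
    case 0
    show ?thesis
    proof (cases "mv_of V y = mv_of V x")
      case True
      then obtain j where "j > 0" "mv_of V (\<rho> j) \<noteq> mv_of V (\<rho> 0)"
        using \<rho>(4)[of 0] crit 0 \<rho>(1) unfolding \<rho>'_def by auto
      then show ?thesis using True 0 \<rho>(1) unfolding \<rho>'_def by (intro exI[of _ "Suc j"]) auto
    next
      case False
      then show ?thesis using 0 \<rho>(1) unfolding \<rho>'_def by (intro exI[of _ 1]) auto
    qed
  next
    case (Suc l)
    then obtain j where "j > l" "mv_of V (\<rho> j) \<noteq> mv_of V (\<rho> l)"
      using \<rho>(4)[of l] crit unfolding \<rho>'_def by auto
    then show ?thesis using Suc unfolding \<rho>'_def by (intro exI[of _ "Suc j"]) auto
  qed
  moreover have "\<rho>' i \<in> A \<and> r (\<rho>' i) (\<rho>' (Suc i))" for i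
    using assms(2,3) \<rho>(1,2,3) unfolding \<rho>'_def by (cases i) auto
  ultimately show ?thesis unfolding ess_ray_def by (intro exI[of _ \<rho>']) (auto simp: \<rho>'_def)
qed

lemma forward_ray_step:
  "forward_ray F A y \<Longrightarrow> y \<in> flow K V {x} \<Longrightarrow> x \<in> A \<Longrightarrow> forward_ray F A x"
  by (rule ess_ray_Cons)

lemma backward_ray_step:
  "backward_ray F A x \<Longrightarrow> y \<in> flow K V {x} \<Longrightarrow> y \<in> A \<Longrightarrow> backward_ray F A y"
  by (rule ess_ray_Cons)

text \<open>Two rays from x glue to a solution. Past and future can thus be extended independently,
  one step at a time, which is what arguments along paths require.\<close>

lemma Inv_iff_rays:
  assumes "A \<subseteq> K"
  shows "x \<in> Inv F K V A \<longleftrightarrow> forward_ray F A x \<and> backward_ray F A x"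
proof
  assume "x \<in> Inv F K V A"
  then obtain \<rho> i where sol: "is_essential_solution F K V \<rho>" and "range \<rho> \<subseteq> A" "\<rho> i = x"
    by (auto simp: Inv_def)
  then have \<rho>: "\<rho> j \<in> A" "\<rho> i = x" for j by auto
  have step: "\<rho> (j + 1) \<in> flow K V {\<rho> j}" for j
    using sol unfolding is_essential_solution_def is_solution_def by simp
  have ess: "\<exists>i1 i2. i1 < j \<and> j < i2 \<and>
      mv_of V (\<rho> i1) \<noteq> mv_of V (\<rho> j) \<and> mv_of V (\<rho> j) \<noteq> mv_of V (\<rho> i2)"
    if "\<not> critical F K (mv_of V (\<rho> j))" for j
    using sol that unfolding is_essential_solution_def by simp
  have "\<exists>j>l. mv_of V (\<rho> (i + int j)) \<noteq> mv_of V (\<rho> (i + int l))"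
    if crit: "\<not> critical F K (mv_of V (\<rho> (i + int l)))" for l
  proof -
    obtain i2 where "i + int l < i2" "mv_of V (\<rho> (i + int l)) \<noteq> mv_of V (\<rho> i2)"
      using ess[OF crit] by blast
    then show ?thesis by (intro exI[of _ "nat (i2 - i)"]) auto
  qed
  then have "forward_ray F A x"
    unfolding ess_ray_def using \<rho> step[of "i + int j" for j]
    by (intro exI[of _ "\<lambda>j. \<rho> (i + int j)"]) (simp add: add.assoc add.commute[of 1])
  moreover have "\<exists>j>l. mv_of V (\<rho> (i - int j)) \<noteq> mv_of V (\<rho> (i - int l))"
    if crit: "\<not> critical F K (mv_of V (\<rho> (i - int l)))" for l
  proof -
    obtain i1 where "i1 < i - int l" "mv_of V (\<rho> i1) \<noteq> mv_of V (\<rho> (i - int l))"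
      using ess[OF crit] by blast
    then show ?thesis by (intro exI[of _ "nat (i - i1)"]) auto
  qed
  then have "backward_ray F A x"
    unfolding ess_ray_def using \<rho> step[of "i - int (Suc j)" for j]
    by (intro exI[of _ "\<lambda>j. \<rho> (i - int j)"]) simp
  ultimately show "forward_ray F A x \<and> backward_ray F A x" ..
next
  assume "forward_ray F A x \<and> backward_ray F A x"
  then obtain f b where
    "f 0 = x" "\<forall>i. f i \<in> A \<and> f (Suc i) \<in> flow K V {f i} \<and>
      (\<not> critical F K (mv_of V (f i)) \<longrightarrow> (\<exists>j>i. mv_of V (f j) \<noteq> mv_of V (f i)))" and
    "b 0 = x" "\<forall>i. b i \<in> A \<and> b i \<in> flow K V {b (Suc i)} \<and>
      (\<not> critical F K (mv_of V (b i)) \<longrightarrow> (\<exists>j>i. mv_of V (b j) \<noteq> mv_of V (b i)))"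
    unfolding ess_ray_def by (elim conjE exE)
  then have f: "f 0 = x" "\<And>i. f i \<in> A" "\<And>i. f (Suc i) \<in> flow K V {f i}"
      "\<And>i. \<not> critical F K (mv_of V (f i)) \<Longrightarrow> \<exists>j>i. mv_of V (f j) \<noteq> mv_of V (f i)"
    and b: "b 0 = x" "\<And>i. b i \<in> A" "\<And>i. b i \<in> flow K V {b (Suc i)}"
      "\<And>i. \<not> critical F K (mv_of V (b i)) \<Longrightarrow> \<exists>j>i. mv_of V (b j) \<noteq> mv_of V (b i)"
    by simp_all
  define \<rho> where "\<rho> z = (if z \<ge> 0 then f (nat z) else b (nat (- z)))" for z :: int
  have \<rho>f: "\<rho> (int j) = f j" and \<rho>b: "\<rho> (- int j) = b j" for j
    unfolding \<rho>_def using f(1) b(1) by auto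
  have "\<rho> (z + 1) \<in> flow K V {\<rho> z}" for z
  proof (cases "z \<ge> 0")
    case True
    then have "\<rho> z = f (nat z)" "\<rho> (z + 1) = f (Suc (nat z))"
      using \<rho>f[of "nat z"] \<rho>f[of "Suc (nat z)"] by (simp_all add: add_ac)
    then show ?thesis using f(3) by simp
  next
    case False
    define j where "j = nat (- z - 1)"
    have "z = - int (Suc j)" "z + 1 = - int j" using False unfolding j_def by auto
    then show ?thesis using b(3) \<rho>b by metis
  qed
  moreover have "\<exists>i2>z. mv_of V (\<rho> z) \<noteq> mv_of V (\<rho> i2)" if crit: "\<not> critical F K (mv_of V (\<rho> z))" for z
  proof -
    \<comment> \<open>A point of the forward ray strictly after z. If it is still in the multivector
      of \<open>\<rho> z\<close>, that multivector is not critical and the ray leaves it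
      later.\<close>
    define l where "l = nat \<bar>z\<bar> + 1"
    have l: "int l > z" unfolding l_def by simp
    show ?thesis
    proof (cases "mv_of V (f l) = mv_of V (\<rho> z)")
      case True
      then obtain j where "j > l" "mv_of V (f j) \<noteq> mv_of V (\<rho> z)" using f(4)[of l] crit by auto
      then show ?thesis using l \<rho>f[of j] by (intro exI[of _ "int j"]) auto
    next
      case False
      then show ?thesis using l \<rho>f[of l] by (intro exI[of _ "int l"]) auto
    qed
  qed
  moreover have "\<exists>i1<z. mv_of V (\<rho> i1) \<noteq> mv_of V (\<rho> z)" if crit: "\<not> critical F K (mv_of V (\<rho> z))" for z
  proof -
    define l where "l = nat \<bar>z\<bar> + 1"
    have l: "- int l < z" unfolding l_def by simp
    show ?thesis
    proof (cases "mv_of V (b l) = mv_of V (\<rho> z)")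
      case True
      then obtain j where "j > l" "mv_of V (b j) \<noteq> mv_of V (\<rho> z)" using b(4)[of l] crit by auto
      then show ?thesis using l \<rho>b[of j] by (intro exI[of _ "- int j"]) auto
    next
      case False
      then show ?thesis using l \<rho>b[of l] by (intro exI[of _ "- int l"]) auto
    qed
  qed
  moreover have \<rho>A: "\<rho> z \<in> A" for z unfolding \<rho>_def using f(2) b(2) by simp
  then have "\<rho> z \<in> K" for z using subsetD[OF assms] by simp
  ultimately have "is_essential_solution F K V \<rho>"
    unfolding is_essential_solution_def is_solution_def by meson
  then show "x \<in> Inv F K V A"
    unfolding Inv_def using \<rho>A \<rho>f[of 0] f by (auto intro!: exI[of _ \<rho>])
qed

section \<open>Push forwards\<close>

lemma push_forwardI:
  assumes "is_path K V n \<rho>" "\<rho> ` {..n} \<subseteq> N" "\<rho> 0 \<in> A" "\<rho> n = \<sigma>"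
  shows "\<sigma> \<in> push_forward K V A N"
proof -
  have "\<sigma> \<in> N" using assms(2,4) by auto
  then show ?thesis unfolding push_forward_def using assms by (intro CollectI conjI exI)
qed

lemma push_forwardE:
  assumes "\<sigma> \<in> push_forward K V A N"
  obtains n \<rho> where "is_path K V n \<rho>" "\<rho> ` {..n} \<subseteq> N" "\<rho> 0 \<in> A" "\<rho> n = \<sigma>"
  using assms unfolding push_forward_def mem_Collect_eq by (elim conjE exE)

lemma push_forward_subset: "push_forward K V A N \<subseteq> N"
  unfolding push_forward_def by blast

lemma push_forward_base:
  assumes "\<sigma> \<in> A" "\<sigma> \<in> N" "N \<subseteq> K"
  shows "\<sigma> \<in> push_forward K V A N"
  unfolding push_forward_def is_path_def
  using assms by (auto intro!: exI[of _ 0] exI[of _ "\<lambda>_. \<sigma>"])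

lemma push_forward_step:
  assumes "\<sigma> \<in> push_forward K V A N" "\<tau> \<in> flow K V {\<sigma>}" "\<tau> \<in> N" "N \<subseteq> K"
  shows "\<tau> \<in> push_forward K V A N"
proof -
  from assms(1) obtain n \<rho> where \<rho>: "is_path K V n \<rho>" "\<rho> ` {..n} \<subseteq> N" "\<rho> 0 \<in> A" "\<rho> n = \<sigma>"
    by (rule push_forwardE)
  define \<rho>' where "\<rho>' = \<rho>(Suc n := \<tau>)"
  have "is_path K V (Suc n) \<rho>'"
    using \<rho>(1,4) assms(2-) unfolding is_path_def \<rho>'_def by (auto simp: less_Suc_eq le_Suc_eq)
  moreover have "\<rho>' ` {..Suc n} \<subseteq> N" "\<rho>' 0 \<in> A" "\<rho>' (Suc n) = \<tau>"
    using \<rho>(2,3) assms(3) unfolding \<rho>'_def by (auto simp: le_Suc_eq image_subset_iff)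
  ultimately show ?thesis by (rule push_forwardI)
qed

lemma push_forward_induct [consumes 1, case_names base step]:
  assumes "\<sigma> \<in> push_forward K V A N"
    and base: "\<And>x. x \<in> A \<Longrightarrow> x \<in> N \<Longrightarrow> Q x"
    and step: "\<And>x y. x \<in> N \<Longrightarrow> Q x \<Longrightarrow> y \<in> N \<Longrightarrow> y \<in> flow K V {x} \<Longrightarrow> Q y"
  shows "Q \<sigma>"
proof -
  from assms(1) obtain n \<rho> where \<rho>: "is_path K V n \<rho>" "\<rho> ` {..n} \<subseteq> N" "\<rho> 0 \<in> A" "\<rho> n = \<sigma>"
    by (rule push_forwardE)
  have N: "\<rho> i \<in> N" if "i \<le> n" for i using \<rho>(2) that by auto
  have "Q (\<rho> i)" if "i \<le> n" for i
    using that
  proof (induction i)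
    case 0
    then show ?case using \<rho> base by auto
  next
    case (Suc i)
    then show ?case using \<rho>(1) N[of i] N[of "Suc i"] step[of "\<rho> i" "\<rho> (Suc i)"] unfolding is_path_def by auto
  qed
  then show ?thesis using \<rho>(4) by blast
qed

lemma push_forward_mono:
  assumes "A \<subseteq> B"
  shows "push_forward K V A N \<subseteq> push_forward K V B N"
proof
  fix \<sigma> assume "\<sigma> \<in> push_forward K V A N"
  then obtain n \<rho> where "is_path K V n \<rho>" "\<rho> ` {..n} \<subseteq> N" "\<rho> 0 \<in> A" "\<rho> n = \<sigma>"
    by (rule push_forwardE)
  with subsetD[OF assms this(3)] show "\<sigma> \<in> push_forward K V B N"
    by (intro push_forwardI)
qed

text \<open>A face of \<sigma> lies in the image of \<sigma> under the flow, so it is reached by one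
  more step.\<close>

lemma closed_push_forward:
  assumes "closed_in_complex K N"
  shows "closed_in_complex K (push_forward K V A N)"
proof (rule closed_in_complexI)
  show "push_forward K V A N \<subseteq> K"
    using push_forward_subset closed_in_complex_subset[OF assms] by blast
next
  fix \<sigma> \<tau> assume *: "\<sigma> \<in> push_forward K V A N" "\<tau> \<in> K" "\<tau> \<subseteq> \<sigma>"
  then have "\<tau> \<in> N" using closed_in_complex_face[OF assms] push_forward_subset by blast
  then show "\<tau> \<in> push_forward K V A N"
    using push_forward_step[OF *(1)] * closed_in_complex_subset[OF assms] by (simp add: flow_singleton)
qed

section \<open>Index pairs\<close>

context
  fixes S P E :: "'v set set"
  assumes index_pair: "index_pair TYPE('f::field) K V S P E"
begin

lemma closed_P: "closed_in_complex K P" and closed_E: "closed_in_complex K E"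
  and E_subset: "E \<subseteq> P" and S_eq: "S = Inv TYPE('f) K V (P - E)"
  and P_subset: "P \<subseteq> K"
  using index_pair closed_in_complex_subset unfolding index_pair_def by auto

lemma flow_in_P: "\<sigma> \<in> P - E \<Longrightarrow> \<tau> \<in> flow K V {\<sigma>} \<Longrightarrow> \<tau> \<in> P"
  using index_pair flow_iff[of \<tau> K V "P - E"] unfolding index_pair_def by blast

lemma flow_in_E: "\<sigma> \<in> E \<Longrightarrow> \<tau> \<in> flow K V {\<sigma>} \<Longrightarrow> \<tau> \<in> P \<Longrightarrow> \<tau> \<in> E"
  using index_pair flow_iff[of \<tau> K V E] unfolding index_pair_def by blast

lemma S_subset: "S \<subseteq> P - E"
  using Inv_subset unfolding S_eq .

lemma in_S_iff: "x \<in> S \<longleftrightarrow> forward_ray TYPE('f) (P - E) x \<and> backward_ray TYPE('f) (P - E) x"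
  unfolding S_eq using P_subset by (intro Inv_iff_rays) blast

text \<open>E cannot be left inside P, so \<rho> avoids E; it then has the past of \<sigma> and the
  future of \<tau>. Saturation of S is the case of a detour within a multivector, convexity that of
  a chain of faces.\<close>

lemma between_in_S:
  assumes "\<sigma> \<in> S" "\<tau> \<in> S" "\<rho> \<in> flow K V {\<sigma>}" "\<tau> \<in> flow K V {\<rho>}"
  shows "\<rho> \<in> S"
proof -
  have "\<rho> \<in> P" using flow_in_P assms S_subset by blast
  moreover have "\<rho> \<notin> E" using flow_in_E[of \<rho> \<tau>] assms(2,4) S_subset by blast
  ultimately have "\<rho> \<in> P - E" by blast
  then show ?thesis
    using assms in_S_iff forward_ray_step[of "TYPE('f)" "P - E", OF _ assms(4)] backward_ray_step[of "TYPE('f)" "P - E", OF _ assms(3)] by simp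
qed

lemma S_saturated:
  assumes "\<sigma> \<in> S"
  shows "mv_of V \<sigma> \<subseteq> S"
proof
  fix \<tau> assume \<tau>: "\<tau> \<in> mv_of V \<sigma>"
  have \<sigma>: "\<sigma> \<in> K" using assms S_subset P_subset by blast
  show "\<tau> \<in> S"
    using between_in_S[OF assms assms] \<tau> mv_of_mem[OF \<sigma> \<tau>] self_in_mv_of[OF \<sigma>]
    by (simp add: flow_singleton)
qed

lemma S_convex: "multivector K S"
  unfolding multivector_def
proof (intro conjI ballI impI)
  show "S \<subseteq> K" using S_subset P_subset by blast
  fix \<sigma> \<tau> \<rho> assume "\<sigma> \<in> S" "\<tau> \<in> S" "\<rho> \<in> K" "\<sigma> \<subseteq> \<rho> \<and> \<rho> \<subseteq> \<tau>"
  then show "\<rho> \<in> S"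
    using between_in_S[of \<tau> \<sigma> \<rho>] \<open>S \<subseteq> K\<close> by (auto simp: flow_singleton)
qed

lemma closed_pair_S: "closed_pair K (cl K S, mo K S)"
  using closed_mo[OF S_convex] by (auto simp: closed_pair_def closed_in_complex_cl mo_def)

lemma cl_S: "cl K S \<subseteq> P" "S \<subseteq> cl K S" "cl K S = S \<union> mo K S"
  using S_subset closed_in_complex_face[OF closed_P] P_subset unfolding cl_def mo_def by blast+

abbreviation "Q1 \<equiv> push_forward K V (cl K S) P"
abbreviation "Q2 \<equiv> push_forward K V (mo K S) P"

lemma closed_Q1: "closed_in_complex K Q1" and closed_Q2: "closed_in_complex K Q2"
  using closed_push_forward[OF closed_P] by auto

lemma Q2_subset_Q1: "Q2 \<subseteq> Q1"
  by (rule push_forward_mono) (simp add: mo_def)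

lemma cl_subset_Q1: "cl K S \<subseteq> Q1" and mo_subset_Q2: "mo K S \<subseteq> Q2"
  using push_forward_base cl_S P_subset by auto

text \<open>S is a union of multivectors, so a step out of S goes to a face and thus into mo S. From
  there on the path stays in Q2.\<close>

lemma push_forward_cl: "Q1 = S \<union> Q2"
proof
  show "Q1 \<subseteq> S \<union> Q2"
  proof
    fix \<sigma> assume "\<sigma> \<in> Q1"
    then show "\<sigma> \<in> S \<union> Q2"
    proof (induction rule: push_forward_induct)
      case (base x)
      then show ?case using cl_S(3) mo_subset_Q2 by blast
    next
      case (step x y)
      show ?case
      proof (cases "x \<in> Q2")
        case True
        then show ?thesis using push_forward_step step P_subset by blast
      next
        case False
        then have x: "x \<in> S" using step by blast
        from step(3) have "y \<in> K \<and> y \<subseteq> x \<or> y \<in> mv_of V x" by (simp only: flow_singleton)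
        then show ?thesis
        proof (rule disjE)
          assume "y \<in> K \<and> y \<subseteq> x"
          then have "y \<in> cl K S" using x unfolding cl_def by blast
          then show ?thesis using cl_S(3) mo_subset_Q2 by blast
        qed (use S_saturated x in blast)
      qed
    qed
  qed
  show "S \<union> Q2 \<subseteq> Q1" using cl_S(2) cl_subset_Q1 Q2_subset_Q1 by blast
qed

text \<open>Points of cl S are one step away from S and inherit its past unless they lie in E. Along
  the path this past is passed on until E is entered, and E is then never left.\<close>

lemma backward_ray_or_exit:
  assumes "x \<in> Q1"
  shows "x \<in> E \<or> backward_ray TYPE('f) (P - E) x"
  using assms
proof (induction rule: push_forward_induct)
  case (base x)
  then obtain s where s: "s \<in> S" "x \<in> flow K V {s}"
    unfolding cl_def flow_singleton by auto
  show ?case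
  proof (cases "x \<in> E")
    case False
    then show ?thesis
      using s(1) in_S_iff[of s] backward_ray_step[of "TYPE('f)" "P - E", OF _ s(2)] base(2) by simp
  qed simp
next
  case (step x y)
  show ?case
  proof (cases "y \<in> E")
    case False
    then have "x \<notin> E" using flow_in_E[of x y] step(2,3) by metis
    with False show ?thesis using step(2,4) backward_ray_step[of "TYPE('f)" "P - E", OF _ step(3)] by simp
  qed simp
qed

lemma S_disjoint_Q2: "S \<inter> Q2 = {}"
proof -
  \<comment> \<open>Membership in Q1 is carried along because it supplies the past of x. If the next
    step led back to S, then x would also have a future and lie in S.\<close>
  have "x \<in> Q1 \<and> x \<notin> S" if "x \<in> Q2" for x
    using that
  proof (induction rule: push_forward_induct)
    case (base x)
    then show ?case using mo_subset_Q2 Q2_subset_Q1 by (auto simp: mo_def)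
  next
    case (step x y)
    then have "y \<in> Q1" using push_forward_step P_subset by blast
    moreover have "y \<notin> S"
    proof
      assume y: "y \<in> S"
      then have "y \<notin> E" using S_subset by blast
      then have x: "x \<notin> E" using flow_in_E[of x y] step(2,3) by metis
      then have "backward_ray TYPE('f) (P - E) x" using backward_ray_or_exit[of x] step(4) by simp
      moreover have "forward_ray TYPE('f) (P - E) x"
        using y in_S_iff[of y] forward_ray_step[of "TYPE('f)" "P - E", OF _ step(3)] step(1) x by simp
      ultimately show False using step(4) in_S_iff[of x] by simp
    qed
    ultimately show ?case ..
  qed
  then show ?thesis by blast
qed

text \<open>Steps within a multivector can be reversed, so a point of E in it would carry \<sigma>
  into E.\<close>

lemma mv_of_avoids_E: "\<sigma> \<in> P - E \<Longrightarrow> mv_of V \<sigma> \<subseteq> P - E"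
proof
  fix \<tau> assume \<sigma>: "\<sigma> \<in> P - E" and \<tau>: "\<tau> \<in> mv_of V \<sigma>"
  have K: "\<sigma> \<in> K" using \<sigma> P_subset by blast
  have "\<tau> \<in> P" using flow_in_P[OF \<sigma>] \<tau> by (simp add: flow_singleton)
  moreover have "\<sigma> \<in> flow K V {\<tau>}"
    using mv_of_mem[OF K \<tau>] self_in_mv_of[OF K] by (simp add: flow_singleton)
  then have "\<tau> \<notin> E" using flow_in_E[of \<tau> \<sigma>] \<sigma> by blast
  ultimately show "\<tau> \<in> P - E" by blast
qed

section \<open>The three inclusions that make up a connection\<close>

lemma R_pair_eq: "R_pair K V S P E = (Q1, E \<inter> Q2)"
  using push_forward_subset unfolding R_pair_def by blast

lemma closed_pairs:
  "closed_pair K (P, E)" "closed_pair K (Q_pair K V S P)" "closed_pair K (R_pair K V S P E)"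
  unfolding closed_pair_def R_pair_eq Q_pair_def
  using closed_P closed_E E_subset closed_Q1 closed_Q2 Q2_subset_Q1 closed_in_complex_Int by auto

lemma cl_pair_in_Q_pair:
  "bij_betw (incl_map k (Q_pair K V S P)) (carrier (homology k (cl K S, mo K S)))
     (carrier (homology k (Q_pair K V S P) :: ('f, ('v set \<Rightarrow> 'f) set) module))"
  unfolding Q_pair_def
proof (rule incl_map_bij)
  \<comment> \<open>With these identities both acyclicity conditions concern pairs of equal
    sets.\<close>
  have "cl K S \<union> Q2 = Q1" "cl K S \<inter> Q2 = mo K S"
    using push_forward_cl cl_S(3) cl_subset_Q1 mo_subset_Q2 S_disjoint_Q2 Q2_subset_Q1 by blast+
  then show "acyclic_pair TYPE('f) Q1 (cl K S \<union> Q2)" "acyclic_pair TYPE('f) (cl K S \<inter> Q2) (mo K S)"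
    using acyclic_pair_refl by auto
qed (use closed_pair_S closed_pairs(2) cl_subset_Q1 mo_subset_Q2 in \<open>auto simp: Q_pair_def\<close>)

lemma R_pair_in_Q_pair:
  "bij_betw (incl_map k (Q_pair K V S P)) (carrier (homology k (R_pair K V S P E)))
     (carrier (homology k (Q_pair K V S P) :: ('f, ('v set \<Rightarrow> 'f) set) module))"
  unfolding Q_pair_def R_pair_eq
proof (rule incl_map_bij)
  have "Q1 \<union> Q2 = Q1" using Q2_subset_Q1 by blast
  then show "acyclic_pair TYPE('f) Q1 (Q1 \<union> Q2)" using acyclic_pair_refl by simp
  \<comment> \<open>Q2 is closed under flow steps that stay in P, which makes the difference
    saturated. Its invariant part lies in S by monotonicity, but Q2 misses S.\<close>
  have "acyclic_pair TYPE('f) Q2 (E \<inter> Q2)"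
  proof (rule acyclic_pair_if_Inv_empty)
    fix \<sigma> assume \<sigma>: "\<sigma> \<in> Q2 - E \<inter> Q2"
    then have "\<sigma> \<in> P - E" using push_forward_subset by blast
    from mv_of_avoids_E[OF this] show "mv_of V \<sigma> \<subseteq> Q2 - E \<inter> Q2"
      using \<sigma> push_forward_step[of \<sigma> _ P] P_subset by (auto simp: flow_singleton)
  next
    have "Inv TYPE('f) K V (Q2 - E \<inter> Q2) \<subseteq> S"
      unfolding S_eq using push_forward_subset by (intro Inv_mono) blast
    then show "Inv TYPE('f) K V (Q2 - E \<inter> Q2) = {}"
      using Inv_subset[of "TYPE('f)" K V "Q2 - E \<inter> Q2"] S_disjoint_Q2 by blast
  qed (use closed_Q2 closed_E closed_in_complex_Int in auto)
  then show "acyclic_pair TYPE('f) (Q1 \<inter> Q2) (E \<inter> Q2)"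
    using Q2_subset_Q1 by (simp add: inf_absorb2)
qed (use closed_pairs in \<open>auto simp: Q_pair_def R_pair_eq\<close>)

lemma R_pair_in_index_pair:
  "bij_betw (incl_map k (P, E)) (carrier (homology k (R_pair K V S P E)))
     (carrier (homology k (P, E) :: ('f, ('v set \<Rightarrow> 'f) set) module))"
  unfolding R_pair_eq
proof (rule incl_map_bij)
  \<comment> \<open>S avoids E, so Q1 and Q2 have the same trace on E.\<close>
  have "Q1 \<inter> E = E \<inter> Q2" using push_forward_cl S_subset by blast
  then show "acyclic_pair TYPE('f) (Q1 \<inter> E) (E \<inter> Q2)" using acyclic_pair_refl by simp
  show "acyclic_pair TYPE('f) P (Q1 \<union> E)"
  proof (rule acyclic_pair_if_Inv_empty)
    fix \<sigma> assume \<sigma>: "\<sigma> \<in> P - (Q1 \<union> E)"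
    then have K: "\<sigma> \<in> K" using P_subset by blast
    show "mv_of V \<sigma> \<subseteq> P - (Q1 \<union> E)"
    proof
      fix \<tau> assume \<tau>: "\<tau> \<in> mv_of V \<sigma>"
      have "\<tau> \<in> P - E" using mv_of_avoids_E \<sigma> \<tau> by blast
      moreover have "\<sigma> \<in> flow K V {\<tau>}"
        using mv_of_mem[OF K \<tau>] self_in_mv_of[OF K] by (simp add: flow_singleton)
      \<comment> \<open>Complements of push forwards are saturated because steps within a
        multivector are reversible: if \<tau> were reached from cl S, one more step would reach
        \<sigma>.\<close>
      then have "\<tau> \<notin> Q1" using push_forward_step[of \<tau>] \<sigma> P_subset by blast
      ultimately show "\<tau> \<in> P - (Q1 \<union> E)" by blast
    qed
  next
    have "Inv TYPE('f) K V (P - (Q1 \<union> E)) \<subseteq> S"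
      unfolding S_eq by (intro Inv_mono) blast
    then show "Inv TYPE('f) K V (P - (Q1 \<union> E)) = {}"
      using Inv_subset[of "TYPE('f)" K V "P - (Q1 \<union> E)"] push_forward_cl by blast
  qed (use closed_P closed_E closed_Q1 E_subset push_forward_subset closed_in_complex_Un in auto)
qed (use closed_pairs push_forward_subset in \<open>auto simp: R_pair_eq\<close>)

end

end

section \<open>Zigzag modules with invertible arrows\<close>

definition linear_iso :: "('f::field, 'a) module \<Rightarrow> ('f, 'b) module \<Rightarrow> ('a \<Rightarrow> 'b) \<Rightarrow> bool" where
  "linear_iso V W f \<longleftrightarrow> linear_map class_ring V W f \<and> bij_betw f (carrier V) (carrier W)"

lemma linear_mapD:
  assumes "linear_map class_ring V W f"
  shows "vectorspace class_ring V" "vectorspace class_ring W"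
    and "x \<in> carrier V \<Longrightarrow> f x \<in> carrier W"
    and "x \<in> carrier V \<Longrightarrow> y \<in> carrier V \<Longrightarrow> f (x \<oplus>\<^bsub>V\<^esub> y) = f x \<oplus>\<^bsub>W\<^esub> f y"
    and "x \<in> carrier V \<Longrightarrow> f (a \<odot>\<^bsub>V\<^esub> x) = a \<odot>\<^bsub>W\<^esub> f x"
proof -
  from assms show "vectorspace class_ring V" "vectorspace class_ring W"
    by (simp_all add: linear_map_def)
  from assms have "f \<in> LinearCombinations.module_hom class_ring V W"
    by (simp add: linear_map_def mod_hom_def mod_hom_axioms_def)
  then show "x \<in> carrier V \<Longrightarrow> f x \<in> carrier W"
    and "x \<in> carrier V \<Longrightarrow> y \<in> carrier V \<Longrightarrow> f (x \<oplus>\<^bsub>V\<^esub> y) = f x \<oplus>\<^bsub>W\<^esub> f y"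
    and "x \<in> carrier V \<Longrightarrow> f (a \<odot>\<^bsub>V\<^esub> x) = a \<odot>\<^bsub>W\<^esub> f x"
    by (auto simp: LinearCombinations.module_hom_def)
qed

lemma linear_iso_comp:
  assumes "linear_iso U V f" "linear_iso V W g"
  shows "linear_iso U W (g \<circ> f)"
proof -
  have f: "linear_map class_ring U V f" and g: "linear_map class_ring V W g"
    using assms by (simp_all add: linear_iso_def)
  have "linear_map class_ring U W (g \<circ> f)"
    by (rule linear_mapI[OF linear_mapD(1)[OF f] linear_mapD(2)[OF g]])
      (simp_all add: linear_mapD(3-5)[OF f] linear_mapD(3-5)[OF g])
  then show ?thesis using assms bij_betw_trans[of f "carrier U" "carrier V" g "carrier W"] by (simp add: linear_iso_def)
qed

lemma linear_iso_inv:
  assumes "linear_iso V W f"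
  shows "linear_iso W V (inv_into (carrier V) f)"
proof -
  let ?g = "inv_into (carrier V) f"
  have f: "linear_map class_ring V W f" and bij: "bij_betw f (carrier V) (carrier W)"
    using assms by (simp_all add: linear_iso_def)
  interpret V: vectorspace class_ring V by (rule linear_mapD(1)[OF f])
  have g: "?g y \<in> carrier V" "f (?g y) = y" if "y \<in> carrier W" for y
    using bij_betwE[OF bij_betw_inv_into[OF bij]] bij_betw_inv_into_right[OF bij] that by auto
  have eq: "?g y = x" if "x \<in> carrier V" "y = f x" for x y
    using bij_betw_inv_into_left[OF bij that(1)] that(2) by simp
  have "linear_map class_ring W V ?g"
  proof (rule linear_mapI[OF linear_mapD(2,1)[OF f]])
    show "?g (x \<oplus>\<^bsub>W\<^esub> y) = ?g x \<oplus>\<^bsub>V\<^esub> ?g y" if "x \<in> carrier W" "y \<in> carrier W" for x y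
      by (rule eq) (simp_all add: g that linear_mapD(4)[OF f])
    show "?g (a \<odot>\<^bsub>W\<^esub> x) = a \<odot>\<^bsub>V\<^esub> ?g x" if "x \<in> carrier W" for a x
      by (rule eq) (simp_all add: g that linear_mapD(5)[OF f])
  qed (rule g)
  then show ?thesis using bij_betw_inv_into[OF bij] by (simp add: linear_iso_def)
qed

text \<open>Spelled like the spaces of a sum of m full interval modules, so that
  \<open>zigzag_sum_full\<close> is an equality of records.\<close>

definition coord_space :: "nat \<Rightarrow> ('f::field, nat \<Rightarrow> 'f) module" where
  "coord_space m = direct_sum_list (replicate m
     \<lparr>carrier = UNIV, mult = (\<lambda>_ _. 0), one = 0, zero = 0, add = (+), smult = (*)\<rparr>)"

lemma coord_space_simps:
  "carrier (coord_space m) = {..<m} \<rightarrow>\<^sub>E UNIV"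
  "zero (coord_space m) = (\<lambda>j\<in>{..<m}. 0)"
  "add (coord_space m) x y = (\<lambda>j\<in>{..<m}. x j + y j)"
  "smult (coord_space m) a x = (\<lambda>j\<in>{..<m}. a * x j)"
  unfolding coord_space_def direct_sum_list_def Let_def
  by (auto intro!: PiE_cong restrict_ext)

lemma coord_space_vectorspace: "vectorspace class_ring (coord_space m :: ('f::field, nat \<Rightarrow> 'f) module)"
proof (rule vs_criteria, goal_cases)
  case 1
  then show ?case by (rule class_field)
next
  case 4
  show ?case
  proof
    fix v :: "nat \<Rightarrow> 'f"
    show "\<exists>w\<in>carrier (coord_space m). v \<oplus>\<^bsub>coord_space m\<^esub> w = \<zero>\<^bsub>coord_space m\<^esub>"
      by (intro bexI[of _ "\<lambda>j\<in>{..<m}. - v j"]) (auto simp: coord_space_simps intro!: restrict_ext)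
  qed
qed (simp_all add: coord_space_simps algebra_simps PiE_restrict cong: restrict_cong)

lemma linear_iso_coord_space:
  fixes V :: "('f::field, 'a) module"
  assumes "vectorspace class_ring V" "finite (carrier V)"
  shows "\<exists>\<psi>. linear_iso (coord_space (vectorspace.dim class_ring V)) V \<psi>"
proof -
  interpret V: vectorspace class_ring V by (rule assms(1))
  \<comment> \<open>The finite carrier is itself the finite spanning set.\<close>
  have "V.span (carrier V) = carrier V"
    by (intro subset_antisym V.span_is_subset2[OF subset_refl] V.in_own_span[OF subset_refl])
  with assms(2) have "V.fin_dim"
    unfolding V.fin_dim_def by (intro exI[of _ "carrier V"] conjI subset_refl)
  from V.finite_basis_exists[OF this] obtain \<beta> where \<beta>: "finite \<beta>" "V.basis \<beta>"
    by (elim exE conjE)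
  have \<beta>V: "\<beta> \<subseteq> carrier V" using \<beta>(2) by (simp add: V.basis_def)
  have dim: "V.dim = card \<beta>" by (rule V.dim_basis[OF \<beta>])
  let ?m = "card \<beta>"
  obtain e where e: "bij_betw e {..<?m} \<beta>"
    using ex_bij_betw_nat_finite[OF \<beta>(1)] by (auto simp: lessThan_atLeast0)
  define d where "d = inv_into {..<?m} e"
  have d: "d b < ?m" "e (d b) = b" if "b \<in> \<beta>" for b
    using bij_betwE[OF bij_betw_inv_into[OF e]] bij_betw_inv_into_right[OF e] that
    unfolding d_def by auto
  have de: "d (e j) = j" "e j \<in> \<beta>" if "j < ?m" for j
    using bij_betw_inv_into_left[OF e] bij_betwE[OF e] that unfolding d_def by auto
  define \<psi> where "\<psi> x = V.lincomb (\<lambda>b. x (d b)) \<beta>" for x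
  have cong: "V.lincomb a \<beta> = V.lincomb b \<beta>" if "\<And>v. v \<in> \<beta> \<Longrightarrow> a v = b v" for a b
    by (rule V.lincomb_cong[OF refl \<beta>V]) (use that in auto)
  have "linear_map class_ring (coord_space ?m) V \<psi>"
  proof (rule linear_mapI[OF coord_space_vectorspace assms(1)])
    show "\<psi> x \<in> carrier V" for x
      unfolding \<psi>_def by (rule V.lincomb_closed[OF \<beta>V]) simp
    show "\<psi> (x \<oplus>\<^bsub>coord_space ?m\<^esub> y) = \<psi> x \<oplus>\<^bsub>V\<^esub> \<psi> y" for x y
    proof -
      have "\<psi> (x \<oplus>\<^bsub>coord_space ?m\<^esub> y) = V.lincomb (\<lambda>b. x (d b) + y (d b)) \<beta>"
        unfolding \<psi>_def by (rule cong) (simp add: coord_space_simps d)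
      then show ?thesis
        using V.lincomb_sum[OF \<beta>(1) \<beta>V, of "\<lambda>b. x (d b)" "\<lambda>b. y (d b)"] by (simp add: \<psi>_def)
    qed
    show "\<psi> (a \<odot>\<^bsub>coord_space ?m\<^esub> x) = a \<odot>\<^bsub>V\<^esub> \<psi> x" for a x
    proof -
      have "\<psi> (a \<odot>\<^bsub>coord_space ?m\<^esub> x) = V.lincomb (\<lambda>b. a * x (d b)) \<beta>"
        unfolding \<psi>_def by (rule cong) (simp add: coord_space_simps d)
      then show ?thesis
        using V.lincomb_smult[OF \<beta>V, of "\<lambda>b. x (d b)" a] by (simp add: \<psi>_def)
    qed
  qed
  moreover have "bij_betw \<psi> (carrier (coord_space ?m)) (carrier V)"
    unfolding bij_betw_def
  proof
    have unique: "\<exists>!a. a \<in> \<beta> \<rightarrow>\<^sub>E UNIV \<and> V.lincomb a \<beta> = v" if "v \<in> carrier V" for v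
      using V.basis_criterion[OF \<beta>(1) \<beta>V] \<beta>(2) that by simp
    show "inj_on \<psi> (carrier (coord_space ?m))"
    proof (rule inj_onI)
      fix x y :: "nat \<Rightarrow> 'f"
      assume xy: "x \<in> carrier (coord_space ?m)" "y \<in> carrier (coord_space ?m)" "\<psi> x = \<psi> y"
      \<comment> \<open>The coefficients of a vector are unique only as extensional functions on the
        basis, hence the restriction.\<close>
      let ?a = "\<lambda>x. \<lambda>b\<in>\<beta>. x (d b) :: 'f"
      have a: "V.lincomb (?a x) \<beta> = \<psi> x" for x unfolding \<psi>_def by (rule cong) simp
      have "\<psi> x \<in> carrier V" unfolding \<psi>_def by (rule V.lincomb_closed[OF \<beta>V]) simp
      from unique[OF this] have "?a x = ?a y"
        using a[of x] a[of y] xy(3) by (metis (mono_tags, lifting) UNIV_I restrict_PiE_iff)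
      then have "x j = y j" if "j < ?m" for j
        using de[OF that] by (metis restrict_apply')
      then show "x = y" using xy(1,2) unfolding coord_space_simps by (intro PiE_ext) auto
    qed
    show "\<psi> ` carrier (coord_space ?m) = carrier V"
    proof
      show "\<psi> ` carrier (coord_space ?m) \<subseteq> carrier V"
        unfolding \<psi>_def using V.lincomb_closed[OF \<beta>V] by auto
      show "carrier V \<subseteq> \<psi> ` carrier (coord_space ?m)"
      proof
        fix v assume "v \<in> carrier V"
        then obtain a where "V.lincomb a \<beta> = v" using unique by blast
        moreover have "\<psi> (\<lambda>j\<in>{..<?m}. a (e j)) = V.lincomb a \<beta>"
          unfolding \<psi>_def by (rule cong) (simp add: d)
        ultimately show "v \<in> \<psi> ` carrier (coord_space ?m)"
          by (intro image_eqI[of _ _ "\<lambda>j\<in>{..<?m}. a (e j)"]) (auto simp: coord_space_simps)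
      qed
    qed
  qed
  ultimately show ?thesis unfolding dim linear_iso_def by blast
qed

section \<open>Sums of interval modules and uniqueness of the full barcode\<close>

lemma zigzag_sum_intervals:
  fixes Is :: "(nat \<times> nat) list"
  defines "N \<equiv> (zigzag_sum (map interval_module Is) :: ('f::field, nat \<Rightarrow> 'f) zigzag)"
  shows "carrier (space N i) =
      (\<Pi>\<^sub>E j\<in>{..<length Is}. if i \<in> {fst (Is ! j)..snd (Is ! j)} then UNIV else {0})"
    and "arrow N i x = (\<lambda>j\<in>{..<length Is}.
      if i \<in> {fst (Is ! j)..snd (Is ! j)} \<and> Suc i \<in> {fst (Is ! j)..snd (Is ! j)} then x j else 0)"
  unfolding N_def zigzag_sum_def direct_sum_list_def Let_def interval_module_def
  by (auto intro!: PiE_cong restrict_ext)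

lemma zigzag_sum_full:
  fixes m l :: nat
  defines "N \<equiv> (zigzag_sum (map interval_module (replicate m (0, l))) :: ('f::field, nat \<Rightarrow> 'f) zigzag)"
  shows "i \<le> l \<Longrightarrow> space N i = coord_space m"
    and "i < l \<Longrightarrow> x \<in> carrier (coord_space m) \<Longrightarrow> arrow N i x = x"
proof -
  show "i \<le> l \<Longrightarrow> space N i = coord_space m"
    unfolding N_def zigzag_sum_def coord_space_def by (simp add: interval_module_def map_replicate)
  show "i < l \<Longrightarrow> x \<in> carrier (coord_space m) \<Longrightarrow> arrow N i x = x"
    unfolding N_def zigzag_sum_intervals coord_space_simps
    by (auto simp: fun_eq_iff PiE_iff extensional_def)
qed

text \<open>Every space is carried back to the one at index 0 along the arrows, inverted where they
  point forward, and from there to coordinates. The squares commute because the arrows of the sum of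
  full intervals are identities.\<close>

lemma is_barcode_full:
  fixes M :: "('f::{field,finite}, 'a) zigzag"
  assumes "vectorspace class_ring (space M 0)" "finite (carrier (space M 0))"
    and arrows: "\<forall>i<length \<tau>. case \<tau> ! i of
        Forward \<Rightarrow> linear_iso (space M i) (space M (Suc i)) (arrow M i)
      | Backward \<Rightarrow> linear_iso (space M (Suc i)) (space M i) (arrow M i)"
  shows "is_barcode \<tau> M
    (replicate_mset (vectorspace.dim class_ring (space M 0)) (0, length \<tau>))"
proof -
  define m where "m = vectorspace.dim class_ring (space M 0)"
  obtain \<psi> where \<psi>: "linear_iso (coord_space m) (space M 0) \<psi>"
    using linear_iso_coord_space[OF assms(1,2)] unfolding m_def by blast
  define \<phi> where "\<phi> = rec_nat (inv_into (carrier (coord_space m)) \<psi>)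
    (\<lambda>i f. case \<tau> ! i of Forward \<Rightarrow> f \<circ> inv_into (carrier (space M i)) (arrow M i)
       | Backward \<Rightarrow> f \<circ> arrow M i)"
  have \<phi>_simps: "\<phi> 0 = inv_into (carrier (coord_space m)) \<psi>"
    "\<phi> (Suc i) = (case \<tau> ! i of Forward \<Rightarrow> \<phi> i \<circ> inv_into (carrier (space M i)) (arrow M i)
       | Backward \<Rightarrow> \<phi> i \<circ> arrow M i)" for i
    unfolding \<phi>_def by simp_all
  have iso: "linear_iso (space M i) (coord_space m) (\<phi> i)" if "i \<le> length \<tau>" for i
    using that
  proof (induction i)
    case 0
    show ?case unfolding \<phi>_simps by (rule linear_iso_inv[OF \<psi>])
  next
    case (Suc i)
    then have IH: "linear_iso (space M i) (coord_space m) (\<phi> i)" and i: "i < length \<tau>" by simp_all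
    show ?case
    proof (cases "\<tau> ! i")
      case Forward
      then show ?thesis
        using linear_iso_comp[OF linear_iso_inv IH, of "space M (Suc i)" "arrow M i"] arrows[rule_format, OF i]
        by (simp add: \<phi>_simps comp_def)
    next
      case Backward
      then show ?thesis
        using linear_iso_comp[OF _ IH, of "space M (Suc i)" "arrow M i"] arrows[rule_format, OF i]
        by (simp add: \<phi>_simps comp_def)
    qed
  qed
  let ?N = "zigzag_sum (map interval_module (replicate m (0, length \<tau>))) :: ('f, nat \<Rightarrow> 'f) zigzag"
  have "zigzag_iso \<tau> M ?N"
    unfolding zigzag_iso_def
  proof (intro exI[of _ \<phi>] conjI allI impI)
    fix i assume i: "i \<le> length \<tau>"
    show "linear_map class_ring (space M i) (space ?N i) (\<phi> i)"
      and "bij_betw (\<phi> i) (carrier (space M i)) (carrier (space ?N i))"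
      using iso[OF i] unfolding zigzag_sum_full(1)[OF i] linear_iso_def by auto
  next
    fix i assume i: "i < length \<tau>"
    have in_carrier: "\<phi> j x \<in> carrier (coord_space m)"
      if "j \<le> length \<tau>" "x \<in> carrier (space M j)" for j x
      using bij_betwE[of "\<phi> j" "carrier (space M j)" "carrier (coord_space m)"] iso[OF that(1)] that(2) by (simp add: linear_iso_def)
    show "case \<tau> ! i of
             Forward \<Rightarrow> arrow M i \<in> carrier (space M i) \<rightarrow> carrier (space M (Suc i)) \<and>
               (\<forall>x\<in>carrier (space M i). \<phi> (Suc i) (arrow M i x) = arrow ?N i (\<phi> i x))
           | Backward \<Rightarrow> arrow M i \<in> carrier (space M (Suc i)) \<rightarrow> carrier (space M i) \<and>
               (\<forall>x\<in>carrier (space M (Suc i)). \<phi> i (arrow M i x) = arrow ?N i (\<phi> (Suc i) x))"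
    proof (cases "\<tau> ! i")
      case Forward
      then have bij: "bij_betw (arrow M i) (carrier (space M i)) (carrier (space M (Suc i)))"
        using arrows[rule_format, OF i] by (simp add: linear_iso_def)
      have "\<phi> (Suc i) (arrow M i x) = arrow ?N i (\<phi> i x)" if "x \<in> carrier (space M i)" for x
        using zigzag_sum_full(2)[OF i in_carrier] bij_betw_inv_into_left[OF bij that] Forward i that
        by (simp add: \<phi>_simps)
      then show ?thesis using Forward bij_betw_imp_funcset[OF bij] by simp
    next
      case Backward
      then have bij: "bij_betw (arrow M i) (carrier (space M (Suc i))) (carrier (space M i))"
        using arrows[rule_format, OF i] by (simp add: linear_iso_def)
      have "\<phi> i (arrow M i x) = arrow ?N i (\<phi> (Suc i) x)" if "x \<in> carrier (space M (Suc i))" for x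
        using zigzag_sum_full(2)[OF i in_carrier[of "Suc i" x]] Backward i that
        by (simp add: \<phi>_simps)
      then show ?thesis using Backward bij_betw_imp_funcset[OF bij] by simp
    qed
  qed
  then show ?thesis
    unfolding is_barcode_def m_def[symmetric]
    by (intro conjI exI[of _ "replicate m (0, length \<tau>)"]) (auto split: if_splits)
qed

text \<open>A bar that contains only one of two adjacent indices obstructs the bijectivity of the
  arrow between them.\<close>

lemma interval_arrow_bij:
  fixes s t :: "nat \<Rightarrow> bool"
  assumes bij: "bij_betw (\<lambda>x. \<lambda>j\<in>{..<n}. if s j \<and> t j then x j else (0::'f::field))
      (\<Pi>\<^sub>E j\<in>{..<n}. if s j then UNIV else {0}) (\<Pi>\<^sub>E j\<in>{..<n}. if t j then UNIV else {0})"
    and j: "j < n"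
  shows "s j = t j"
proof -
  \<comment> \<open>A unit vector. If only \<open>s j\<close> holds, it has the same image as the
    zero vector; if only \<open>t j\<close> holds, it is not attained.\<close>
  define e :: "nat \<Rightarrow> 'f" where "e = (\<lambda>j'\<in>{..<n}. if j' = j then 1 else 0)"
  have e: "e \<in> (\<Pi>\<^sub>E j\<in>{..<n}. if r j then UNIV else {0})" if "r j" for r
    using that unfolding e_def by (auto simp: PiE_iff)
  have e_j: "e j = 1" using j by (simp add: e_def)
  have "t j" if sj: "s j"
  proof (rule ccontr)
    assume t: "\<not> t j"
    define z :: "nat \<Rightarrow> 'f" where "z = (\<lambda>j'\<in>{..<n}. 0)"
    have z: "z \<in> (\<Pi>\<^sub>E j\<in>{..<n}. if s j then UNIV else {0})"
      unfolding z_def by (auto simp: PiE_iff)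
    have eq: "(\<lambda>j'\<in>{..<n}. if s j' \<and> t j' then e j' else 0) = (\<lambda>j'\<in>{..<n}. if s j' \<and> t j' then z j' else 0)"
      using t by (auto simp: e_def z_def intro!: restrict_ext)
    have "e = z"
      by (rule inj_onD[OF bij_betw_imp_inj_on[OF bij] _ e[of s, OF sj] z]) (rule eq)
    then show False using e_j j by (simp add: z_def)
  qed
  moreover have "s j" if tj: "t j"
  proof (rule ccontr)
    assume s: "\<not> s j"
    have "e \<in> (\<lambda>x. \<lambda>j\<in>{..<n}. if s j \<and> t j then x j else 0) ` (\<Pi>\<^sub>E j\<in>{..<n}. if s j then UNIV else {0})"
      unfolding bij_betw_imp_surj_on[OF bij] by (rule e[of t, OF tj])
    then obtain x where "e = (\<lambda>j\<in>{..<n}. if s j \<and> t j then x j else 0)" by (rule imageE)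
    then have "e j = (if s j \<and> t j then x j else 0)" using j by simp
    then show False using s e_j by simp
  qed
  ultimately show ?thesis by blast
qed

lemma bij_betw_square:
  assumes "bij_betw f A A'" "bij_betw g B B'" "bij_betw a A B"
    and "\<And>x. x \<in> A \<Longrightarrow> g (a x) = b (f x)"
  shows "bij_betw b A' B'"
proof -
  have "bij_betw (g \<circ> a \<circ> inv_into A f) A' B'"
    by (rule bij_betw_trans[OF bij_betw_inv_into[OF assms(1)] bij_betw_trans[OF assms(3,2)]])
  moreover have "b y = (g \<circ> a \<circ> inv_into A f) y" if "y \<in> A'" for y
    using assms(4)[of "inv_into A f y"] bij_betw_inv_into_right[OF assms(1) that]
      bij_betwE[OF bij_betw_inv_into[OF assms(1)]] that by simp
  then have "bij_betw b A' B' = bij_betw (g \<circ> a \<circ> inv_into A f) A' B'" by (rule bij_betw_cong)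
  ultimately show ?thesis by simp
qed

text \<open>Invertible arrows let no bar start or stop on the way. The number of bars is expressed
  by a cardinality because an isomorphism of zigzags preserves this by being bijective.\<close>

lemma is_barcode_full_unique:
  fixes M :: "('f::{field,finite}, 'a) zigzag"
  assumes arrows: "\<forall>i<length \<tau>. case \<tau> ! i of
        Forward \<Rightarrow> linear_iso (space M i) (space M (Suc i)) (arrow M i)
      | Backward \<Rightarrow> linear_iso (space M (Suc i)) (space M i) (arrow M i)"
    and "is_barcode \<tau> M B"
  obtains n where "B = replicate_mset n (0, length \<tau>)" "card (carrier (space M 0)) = card (UNIV :: 'f set) ^ n"
proof -
  from assms(2) obtain Is where Is: "mset Is = B" "\<forall>I\<in>#B. fst I \<le> snd I \<and> snd I \<le> length \<tau>"
    and iso: "zigzag_iso \<tau> M (zigzag_sum (map interval_module Is))"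
    unfolding is_barcode_def by (elim conjE exE)
  define N where "N = (zigzag_sum (map interval_module Is) :: ('f, nat \<Rightarrow> 'f) zigzag)"
  from iso obtain \<phi> where
    \<phi>_iso: "\<forall>i\<le>length \<tau>. linear_map class_ring (space M i) (space N i) (\<phi> i) \<and>
      bij_betw (\<phi> i) (carrier (space M i)) (carrier (space N i))" and
    comm: "\<forall>i<length \<tau>. case \<tau> ! i of
             Forward \<Rightarrow> arrow M i \<in> carrier (space M i) \<rightarrow> carrier (space M (Suc i)) \<and>
               (\<forall>x\<in>carrier (space M i). \<phi> (Suc i) (arrow M i x) = arrow N i (\<phi> i x))
           | Backward \<Rightarrow> arrow M i \<in> carrier (space M (Suc i)) \<rightarrow> carrier (space M i) \<and>
               (\<forall>x\<in>carrier (space M (Suc i)). \<phi> i (arrow M i x) = arrow N i (\<phi> (Suc i) x))"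
    unfolding zigzag_iso_def N_def[symmetric] by (elim exE conjE)
  have \<phi>: "bij_betw (\<phi> i) (carrier (space M i)) (carrier (space N i))" if "i \<le> length \<tau>" for i
    using \<phi>_iso that by simp
  let ?in = "\<lambda>i j. i \<in> {fst (Is ! j)..snd (Is ! j)}"
  have adj: "?in i j = ?in (Suc i) j" if i: "i < length \<tau>" and j: "j < length Is" for i j
  proof (cases "\<tau> ! i")
    case Forward
    have "bij_betw (arrow N i) (carrier (space N i)) (carrier (space N (Suc i)))"
      by (rule bij_betw_square[OF \<phi> \<phi>, where a = "arrow M i"])
        (use arrows[rule_format, OF i] comm i Forward in \<open>force simp: linear_iso_def\<close>)+
    then show ?thesis
      unfolding N_def zigzag_sum_intervals zigzag_sum_intervals(2)[abs_def]
      by (rule interval_arrow_bij[OF _ j])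
  next
    case Backward
    have "bij_betw (arrow N i) (carrier (space N (Suc i))) (carrier (space N i))"
      by (rule bij_betw_square[OF \<phi> \<phi>, where a = "arrow M i"])
        (use arrows[rule_format, OF i] comm i Backward in \<open>force simp: linear_iso_def\<close>)+
    \<comment> \<open>A backward arrow starts at index \<open>Suc i\<close>, so the two membership
      conditions trade places.\<close>
    then show ?thesis
      unfolding N_def zigzag_sum_intervals zigzag_sum_intervals(2)[abs_def]
        conj_commute[of "i \<in> _"]
      by (rule interval_arrow_bij[OF _ j, symmetric])
  qed
  have full: "Is ! j = (0, length \<tau>)" if j: "j < length Is" for j
  proof -
    have "Is ! j \<in># B" using j Is(1) by (metis nth_mem set_mset_mset)
    then have b: "fst (Is ! j) \<le> snd (Is ! j)" "snd (Is ! j) \<le> length \<tau>" using Is(2) by auto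
    \<comment> \<open>Bars are nonempty, so a positive start would separate the start from the index
      before it; an early end is excluded likewise.\<close>
    have "fst (Is ! j) = 0"
      using adj[OF _ j, of "fst (Is ! j) - 1"] b by (cases "fst (Is ! j)") auto
    moreover have "snd (Is ! j) = length \<tau>"
      using adj[OF _ j, of "snd (Is ! j)"] b by (cases "snd (Is ! j) = length \<tau>") auto
    ultimately show ?thesis by (simp add: prod_eq_iff)
  qed
  have "Is = replicate (length Is) (0, length \<tau>)"
    by (rule nth_equalityI) (simp_all add: full)
  then have "B = replicate_mset (length Is) (0, length \<tau>)"
    using Is(1) by (metis mset_replicate)
  moreover have "carrier (space N 0) = {..<length Is} \<rightarrow>\<^sub>E UNIV"
    unfolding N_def zigzag_sum_intervals by (rule PiE_cong) (simp add: full)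
  then have "card (carrier (space M 0)) = card (UNIV :: 'f set) ^ length Is"
    using bij_betw_same_card[OF \<phi>[of 0]] by (simp add: card_PiE)
  ultimately show thesis by (rule that)
qed

lemma full_barcode:
  fixes M :: "('f::{field,finite}, 'a) zigzag"
  assumes "vectorspace class_ring (space M 0)" "finite (carrier (space M 0))"
    and arrows: "\<forall>i<length \<tau>. case \<tau> ! i of
        Forward \<Rightarrow> linear_iso (space M i) (space M (Suc i)) (arrow M i)
      | Backward \<Rightarrow> linear_iso (space M (Suc i)) (space M i) (arrow M i)"
  shows "is_barcode \<tau> M B \<longleftrightarrow>
    B = replicate_mset (vectorspace.dim class_ring (space M 0)) (0, length \<tau>)"
proof
  let ?B = "replicate_mset (vectorspace.dim class_ring (space M 0)) (0::nat, length \<tau>)"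
  have full: "is_barcode \<tau> M ?B"
    by (rule is_barcode_full[OF assms])
  then show "B = ?B \<Longrightarrow> is_barcode \<tau> M B" by simp
  assume "is_barcode \<tau> M B"
  then obtain n where n: "B = replicate_mset n (0, length \<tau>)" "card (carrier (space M 0)) = card (UNIV :: 'f set) ^ n"
    by (rule is_barcode_full_unique[OF arrows])
  \<comment> \<open>The lemma is applied to the known barcode as well, which ties its number of bars
    to the same cardinality.\<close>
  obtain n' where n': "?B = replicate_mset n' (0, length \<tau>)" "card (carrier (space M 0)) = card (UNIV :: 'f set) ^ n'"
    by (rule is_barcode_full_unique[OF arrows full])
  \<comment> \<open>A field has at least two elements, so the powers of its cardinality determine
    the exponent.\<close>
  have "card {0, 1 :: 'f} \<le> card (UNIV :: 'f set)" by (rule card_mono) simp_all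
  then have "n = n'" using n(2) n'(2) power_inject_exp[of "card (UNIV :: 'f set)" n n'] by simp
  then show "B = ?B" using n(1) n'(1) by simp
qed

section \<open>The filtration of connecting index pairs\<close>

text \<open>Recursion on both lists lets one connection of concrete shape be checked by unfolding;
  \<open>zigzag_path_nth\<close> translates back to positions.\<close>

fun zigzag_path :: "('p \<Rightarrow> 'p \<Rightarrow> bool) \<Rightarrow> direction list \<Rightarrow> 'p list \<Rightarrow> bool" where
  "zigzag_path R [] Xs \<longleftrightarrow> length Xs = 1"
| "zigzag_path R (d # ds) (X # Y # Xs) \<longleftrightarrow>
     (case d of Forward \<Rightarrow> R X Y | Backward \<Rightarrow> R Y X) \<and> zigzag_path R ds (Y # Xs)"
| "zigzag_path R (d # ds) _ \<longleftrightarrow> False"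

lemma zigzag_path_nth:
  "zigzag_path R ds Xs \<Longrightarrow> i < length ds \<Longrightarrow>
   (case ds ! i of Forward \<Rightarrow> R (Xs ! i) (Xs ! Suc i) | Backward \<Rightarrow> R (Xs ! Suc i) (Xs ! i))"
proof (induction R ds Xs arbitrary: i rule: zigzag_path.induct)
  case (2 R d ds X Y Xs)
  show ?case
  proof (cases i)
    case 0
    then show ?thesis using 2 by (cases d) simp_all
  next
    case (Suc j)
    then show ?thesis using "2.IH"[of j] "2.prems" by (cases "ds ! j") simp_all
  qed
qed auto

text \<open>The start a is arbitrary so that the induction can split off the first connection.
  Consecutive connections share the pair (P i, E i), so \<open>f i\<close> lists only the five pairs
  in between.\<close>

lemma zigzag_path_connecting:
  assumes step: "\<And>i. a < i \<Longrightarrow> i \<le> a + l \<Longrightarrow>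
      zigzag_path R [Backward, Forward, Backward, Forward, Backward, Forward]
        ((P (i - 1), E (i - 1)) # f i @ [(P i, E i)]) \<and> length (f i) = 5"
  shows "zigzag_path R
      (concat (replicate l [Backward, Forward, Backward, Forward, Backward, Forward]))
      ((P a, E a) # concat (map (\<lambda>i. f i @ [(P i, E i)]) [Suc a..<Suc (a + l)]))"
  using step
proof (induction l arbitrary: a)
  case 0
  then show ?case by simp
next
  case (Suc l)
  have IH: "zigzag_path R
      (concat (replicate l [Backward, Forward, Backward, Forward, Backward, Forward]))
      ((P (Suc a), E (Suc a)) # concat (map (\<lambda>i. f i @ [(P i, E i)]) [Suc (Suc a)..<Suc (Suc a + l)]))"
    using Suc.prems by (intro Suc.IH) auto
  have upt: "[Suc a..<Suc (a + Suc l)] = Suc a # [Suc (Suc a)..<Suc (Suc a + l)]"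
    by (simp add: upt_rec)
  have "length (f (Suc a)) = 5" using Suc.prems[of "Suc a"] by simp
  then obtain x1 x2 x3 x4 x5 where "f (Suc a) = [x1, x2, x3, x4, x5]"
    by (auto simp: length_Suc_conv numeral_eq_Suc)
  then show ?case
    using Suc.prems[of "Suc a"] IH unfolding upt by simp
qed

context complex_on
begin

lemma linear_iso_incl_map:
  fixes X Y :: "'v set set \<times> 'v set set"
  assumes "closed_pair K X" "closed_pair K Y" "fst X \<subseteq> fst Y" "snd X \<subseteq> snd Y"
    and "bij_betw (incl_map k Y) (carrier (homology k X))
      (carrier (homology k Y :: ('f::field, ('v set \<Rightarrow> 'f) set) module))"
  shows "linear_iso (homology k X) (homology k Y :: ('f, ('v set \<Rightarrow> 'f) set) module) (incl_map k Y)"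
  unfolding linear_iso_def by (intro conjI incl_map_linear assms)

end

text \<open>These serve both halves of a connection, since the index pairs at i - 1 and at i both
  belong to S i under \<V> i.\<close>

lemma (in mvf) index_pair_linear_isos:
  assumes "index_pair TYPE('f::field) K V S P E"
  shows "linear_iso (homology k (R_pair K V S P E))
      (homology k (P, E) :: ('f, ('v set \<Rightarrow> 'f) set) module) (incl_map k (P, E))"
    and "linear_iso (homology k (R_pair K V S P E))
      (homology k (Q_pair K V S P) :: ('f, ('v set \<Rightarrow> 'f) set) module) (incl_map k (Q_pair K V S P))"
    and "linear_iso (homology k (cl K S, mo K S))
      (homology k (Q_pair K V S P) :: ('f, ('v set \<Rightarrow> 'f) set) module) (incl_map k (Q_pair K V S P))"
proof -
  note closed = closed_pairs[OF assms] closed_pair_S[OF assms]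
  show "linear_iso (homology k (R_pair K V S P E))
      (homology k (P, E) :: ('f, ('v set \<Rightarrow> 'f) set) module) (incl_map k (P, E))"
    by (rule linear_iso_incl_map[OF closed(3,1) _ _ R_pair_in_index_pair[OF assms]])
      (simp_all add: R_pair_def)
  show "linear_iso (homology k (R_pair K V S P E))
      (homology k (Q_pair K V S P) :: ('f, ('v set \<Rightarrow> 'f) set) module) (incl_map k (Q_pair K V S P))"
    by (rule linear_iso_incl_map[OF closed(3,2) _ _ R_pair_in_Q_pair[OF assms]])
      (simp_all add: R_pair_def Q_pair_def)
  show "linear_iso (homology k (cl K S, mo K S))
      (homology k (Q_pair K V S P) :: ('f, ('v set \<Rightarrow> 'f) set) module) (incl_map k (Q_pair K V S P))"
    by (rule linear_iso_incl_map[OF closed(4,2) _ _ cl_pair_in_Q_pair[OF assms]])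
      (simp_all add: Q_pair_def cl_subset_Q1[OF assms] mo_subset_Q2[OF assms])
qed

theorem theorem27:
  fixes K :: "'v::linorder set set"
    and \<V> :: "nat \<Rightarrow> 'v set set set"
    and S P E :: "nat \<Rightarrow> 'v set set"
    and n k m :: nat
  defines "\<tau> \<equiv> connecting_type n"
    and "H \<equiv> (homology_zigzag k (connecting_type n) (connecting_filtration K \<V> S P E n)
                :: ('f::{field,finite}, ('v set \<Rightarrow> 'f) set) zigzag)"
  assumes "simplicial_complex K"
    and "1 \<le> n"
    and "\<forall>i\<in>{1..n + 1}. multivector_field K (\<V> i)"
    and "\<forall>i\<in>{1..n + 1}. isolated_invariant_set TYPE('f) K (\<V> i) (S i)"
    and "\<forall>i\<in>{1..n}. index_pair TYPE('f) K (\<V> i) (S i) (P i) (E i) \<and>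
                    index_pair TYPE('f) K (\<V> (i + 1)) (S (i + 1)) (P i) (E i)"
    and "vectorspace.dim class_ring
           (homology k (P 1, E 1) :: ('f, ('v set \<Rightarrow> 'f) set) module) = m"
  shows "(\<exists>!B. is_barcode \<tau> H B) \<and> count (barcode \<tau> H) (0, length \<tau>) = m"
proof -
  interpret complex_on K using assms(3) by (rule complex_on.intro)
  define R where "R X Y \<longleftrightarrow> linear_iso (homology k X)
      (homology k Y :: ('f, ('v set \<Rightarrow> 'f) set) module) (incl_map k Y)" for X Y
  define f where "f i = [R_pair K (\<V> i) (S i) (P (i - 1)) (E (i - 1)),
        Q_pair K (\<V> i) (S i) (P (i - 1)), (cl K (S i), mo K (S i)),
        Q_pair K (\<V> i) (S i) (P i), R_pair K (\<V> i) (S i) (P i) (E i)]" for i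
  define Xs where "Xs = connecting_filtration K \<V> S P E n"
  have Xs: "Xs = (P 1, E 1) # concat (map (\<lambda>i. f i @ [(P i, E i)]) [Suc 1..<Suc (1 + (n - 1))])"
    using assms(4) unfolding Xs_def connecting_filtration_def f_def by (simp add: numeral_2_eq_2)
  have path: "zigzag_path R \<tau> Xs"
    unfolding Xs \<tau>_def connecting_type_def
  proof (rule zigzag_path_connecting)
    fix i assume i: "1 < i" "i \<le> 1 + (n - 1)"
    then have "multivector_field K (\<V> i)" using assms(5) by simp
    then interpret mvf K "\<V> i" by unfold_locales
    \<comment> \<open>The pair at i - 1 is an index pair for the invariant set at i - 1 + 1, which
      is i because i > 1.\<close>
    have "i \<in> {1..n}" "i - 1 \<in> {1..n}" "i - 1 + 1 = i" using i by auto
    with assms(7) have "index_pair TYPE('f) K (\<V> i) (S i) (P i) (E i)"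
      "index_pair TYPE('f) K (\<V> i) (S i) (P (i - 1)) (E (i - 1))" by metis+
    note isos = this[THEN index_pair_linear_isos(1)] this[THEN index_pair_linear_isos(2)]
      this[THEN index_pair_linear_isos(3)]
    then show "zigzag_path R [Backward, Forward, Backward, Forward, Backward, Forward]
        ((P (i - 1), E (i - 1)) # f i @ [(P i, E i)]) \<and> length (f i) = 5"
      by (simp add: f_def R_def)
  qed
  have space: "space H i = homology k (Xs ! i)" for i
    by (simp add: H_def homology_zigzag_def Xs_def)
  have arrow: "arrow H i = (case \<tau> ! i of
      Forward \<Rightarrow> incl_map k (Xs ! Suc i) | Backward \<Rightarrow> incl_map k (Xs ! i))" for i
    unfolding H_def homology_zigzag_def Xs_def \<tau>_def by simp
  have arrows: "\<forall>i<length \<tau>. case \<tau> ! i of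
        Forward \<Rightarrow> linear_iso (space H i) (space H (Suc i)) (arrow H i)
      | Backward \<Rightarrow> linear_iso (space H (Suc i)) (space H i) (arrow H i)"
  proof (intro allI impI)
    fix i assume "i < length \<tau>"
    from zigzag_path_nth[OF path this] show "case \<tau> ! i of
        Forward \<Rightarrow> linear_iso (space H i) (space H (Suc i)) (arrow H i)
      | Backward \<Rightarrow> linear_iso (space H (Suc i)) (space H i) (arrow H i)"
      by (cases "\<tau> ! i") (simp_all add: space arrow R_def)
  qed
  have "1 \<in> {1..n + 1}" "1 \<in> {1..n}" using assms(4) by auto
  then have "multivector_field K (\<V> 1)" "index_pair TYPE('f) K (\<V> 1) (S 1) (P 1) (E 1)"
    using assms(5,7) by auto
  then interpret V1: mvf K "\<V> 1" by unfold_locales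
  have closed: "closed_pair K (P 1, E 1)"
    using V1.closed_pairs(1) \<open>index_pair TYPE('f) K (\<V> 1) (S 1) (P 1) (E 1)\<close> .
  have H0: "space H 0 = homology k (P 1, E 1)"
    by (simp add: space Xs)
  have "vectorspace class_ring (space H 0)" "finite (carrier (space H 0))"
    unfolding H0 using closed by (rule homology_vectorspace, rule finite_homology)
  from full_barcode[OF this arrows]
  have *: "is_barcode \<tau> H B \<longleftrightarrow> B = replicate_mset m (0, length \<tau>)" for B
    unfolding H0 assms(8) .
  \<comment> \<open>Uniqueness makes the definite description denote m bars, each from the first
    position 0 to the last position \<open>length \<tau>\<close>.\<close>
  have "barcode \<tau> H = replicate_mset m (0, length \<tau>)"
    unfolding barcode_def by (rule the_equality) (simp_all add: *)
  then show ?thesis using * by simp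
qed

end
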